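(* The process $X^m(t)$ describing the FCFS parallel matching queue is a Markov chain. It is ergodic if and only if $\lambda_C<\mu_{\mathcal{S}(C)}$ for every nonempty $C\subseteq\mathcal{C}$, and its stationary distribution is given, up to a normalizing constant, by $$P^m(c^1,\dots,c^L)\ \propto\ \prod_{\ell=1}^L\frac{\lambda_{c^\ell}}{\mu_{\mathcal{S}(\{c^1,\dots,c^\ell\})}} .$$
   Context: Customer types are $\mathcal{C}=\{c_1,\dots,c_I\}$, server types are $\mathcal{S}=\{s_1,\dots,s_J\}$, and $\mathfrak{E}\subseteq\mathcal{S}\times\mathcal{C}$ is a compatibility relation; $(s_j,c_i)\in\mathfrak{E}$ means $s_j$ can serve $c_i$. $\mathcal{S}(c_i)$ is the set of server types compatible with $c_i$; $\mathcal{S}(C)=\bigcup_{c\in C}\mathcal{S}(c)$. Rates $\lambda_{c_i}>0$, $\mu_{s_j}>0$ are given; $\lambda_C=\sum_{c\in C}\lambda_c$, $\mu_S=\sum_{s\in S}\mu_s$. Ergodic means irreducible and positive recurrent. Empty products equal $1$. FCFS parallel matching queue: customers of type $c_i$ arrive in Poisson streams of rates $\lambda_{c_i}$ and servers of type $s_j$ arrive in Poisson streams of rates $\mu_{s_j}$, all streams independent. Customers queue in order of arrival. An arriving server is matched with the longest waiting customer compatible with it and both leave immediately; if there is no compatible customer in the queue, the server leaves immediately alone. $X^m(t)=(c^1,\dots,c^L)$, $L\ge0$, lists the types of the customers in the queue at time $t$ in order of arrival, $c^1$ being the longest waiting; the states are all finite sequences of elements of $\mathcal{C}$. *)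

theory Defs
  imports "HOL-Probability.Probability"
begin

section \<open>Poisson streams\<close>

text \<open>A stream is given by its random set of arrival epochs.\<close>

definition arrivals :: "('w \<Rightarrow> real set) \<Rightarrow> real \<Rightarrow> real \<Rightarrow> 'w \<Rightarrow> nat" where
  "arrivals T s t \<omega> = card (T \<omega> \<inter> {s<..t})"

definition poisson_stream :: "'w measure \<Rightarrow> real \<Rightarrow> ('w \<Rightarrow> real set) \<Rightarrow> bool" where
  "poisson_stream M r T \<longleftrightarrow>
     (\<forall>\<omega>\<in>space M. T \<omega> \<subseteq> {0<..} \<and> (\<forall>t. finite (T \<omega> \<inter> {..t}))) \<and>
     (\<forall>t\<ge>0. arrivals T 0 t \<in> measurable M (count_space UNIV)) \<and>
     (\<forall>s t. 0 \<le> s \<and> s < t \<longrightarrow>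
        distr M (count_space UNIV) (arrivals T s t) = measure_pmf (poisson_pmf (r * (t - s)))) \<and>
     (\<forall>\<tau> :: nat \<Rightarrow> real. 0 \<le> \<tau> 0 \<and> strict_mono \<tau> \<longrightarrow>
        prob_space.indep_vars M (\<lambda>_. count_space UNIV)
          (\<lambda>i. arrivals T (\<tau> i) (\<tau> (Suc i))) UNIV)"

definition counting_path :: "('w \<Rightarrow> real set) \<Rightarrow> 'w \<Rightarrow> real \<Rightarrow> nat" where
  "counting_path T \<omega> = (\<lambda>t\<in>{0..}. arrivals T 0 t \<omega>)"

abbreviation path_space :: "(real \<Rightarrow> nat) measure" where
  "path_space \<equiv> PiM {0..} (\<lambda>_. count_space UNIV)"

definition independent_streams :: "'w measure \<Rightarrow> ('k \<Rightarrow> 'w \<Rightarrow> real set) \<Rightarrow> bool" where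
  "independent_streams M A \<longleftrightarrow>
     prob_space.indep_vars M (\<lambda>_. path_space) (\<lambda>k. counting_path (A k)) UNIV"

definition independent_initial_state ::
  "'w measure \<Rightarrow> ('k \<Rightarrow> 'w \<Rightarrow> real set) \<Rightarrow> ('w \<Rightarrow> 'q) \<Rightarrow> bool" where
  "independent_initial_state M A X0 \<longleftrightarrow>
     prob_space.indep_set M
       (sets (vimage_algebra (space M) X0 (count_space UNIV)))
       (sets (vimage_algebra (space M) (\<lambda>\<omega> k. counting_path (A k) \<omega>)
          (PiM UNIV (\<lambda>_. path_space))))"


section \<open>The FCFS parallel matching queue\<close>

text \<open>
  Customer types are the elements of the finite type \<open>'c\<close>, server types those of the finite
  type \<open>'s\<close>.  A state lists the types of the waiting customers, longest waiting first.
  An arrival is \<open>Inl c\<close> (a customer) or \<open>Inr s\<close> (a server).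
\<close>

definition compatible_servers :: "('s \<times> 'c) set \<Rightarrow> 'c set \<Rightarrow> 's set" where
  "compatible_servers E C = (\<Union>c\<in>C. {s. (s, c) \<in> E})"

fun remove_served :: "('s \<times> 'c) set \<Rightarrow> 's \<Rightarrow> 'c list \<Rightarrow> 'c list" where
  "remove_served E s [] = []"
| "remove_served E s (c # q) = (if (s, c) \<in> E then q else c # remove_served E s q)"

fun queue_step :: "('s \<times> 'c) set \<Rightarrow> 'c + 's \<Rightarrow> 'c list \<Rightarrow> 'c list" where
  "queue_step E (Inl c) q = q @ [c]"
| "queue_step E (Inr s) q = remove_served E s q"

text \<open>
  The types of all arrivals in the time interval from 0 (exclusive) to \<open>t\<close> (inclusive),
  in chronological order.  Simultaneous arrivals have probability 0; they are processed in an
  arbitrary fixed order of the types (the one given by \<open>to_nat\<close>).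
\<close>

definition arrival_word ::
  "('k::countable \<Rightarrow> 'w \<Rightarrow> real set) \<Rightarrow> real \<Rightarrow> 'w \<Rightarrow> 'k list" where
  "arrival_word A t \<omega> =
     concat (map (\<lambda>\<tau>. map from_nat (sorted_list_of_set (to_nat ` {k. \<tau> \<in> A k \<omega>})))
       (sorted_list_of_set ((\<Union>k. A k \<omega>) \<inter> {0<..t})))"

definition matching_queue ::
  "('s::finite \<times> 'c::finite) set \<Rightarrow> ('c + 's \<Rightarrow> 'w \<Rightarrow> real set) \<Rightarrow>
    'c list \<Rightarrow> real \<Rightarrow> 'w \<Rightarrow> 'c list" where
  "matching_queue E A q t \<omega> = fold (queue_step E) (arrival_word A t \<omega>) q"


section \<open>Continuous-time Markov chains on a countable state space\<close>

definition transition_function :: "(real \<Rightarrow> 'q \<Rightarrow> 'q \<Rightarrow> real) \<Rightarrow> bool" where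
  "transition_function P \<longleftrightarrow>
     (\<forall>t\<ge>0. \<forall>x y. 0 \<le> P t x y) \<and>
     (\<forall>t\<ge>0. \<forall>x. (P t x has_sum 1) UNIV) \<and>
     (\<forall>x y. P 0 x y = of_bool (x = y)) \<and>
     (\<forall>s\<ge>0. \<forall>t\<ge>0. \<forall>x z. ((\<lambda>y. P s x y * P t y z) has_sum P (s + t) x z) UNIV) \<and>
     (\<forall>x. ((\<lambda>t. P t x x) \<longlongrightarrow> 1) (at_right 0))"

definition markov_chain ::
  "'w measure \<Rightarrow> (real \<Rightarrow> 'q \<Rightarrow> 'q \<Rightarrow> real) \<Rightarrow> (real \<Rightarrow> 'w \<Rightarrow> 'q) \<Rightarrow> bool" where
  "markov_chain M P Y \<longleftrightarrow>
     transition_function P \<and>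
     (\<forall>t\<ge>0. Y t \<in> measurable M (count_space UNIV)) \<and>
     (\<forall>(n::nat) \<tau> x u y.
        0 \<le> \<tau> 0 \<and> (\<forall>i<n. \<tau> i < \<tau> (Suc i)) \<and> \<tau> n < u \<and>
        \<P>(\<omega> in M. \<forall>i\<le>n. Y (\<tau> i) \<omega> = x i) > 0 \<longrightarrow>
        \<P>(\<omega> in M. Y u \<omega> = y \<bar> \<forall>i\<le>n. Y (\<tau> i) \<omega> = x i) = P (u - \<tau> n) (x n) y)"

definition stationary_distribution :: "(real \<Rightarrow> 'q \<Rightarrow> 'q \<Rightarrow> real) \<Rightarrow> ('q \<Rightarrow> real) \<Rightarrow> bool" where
  "stationary_distribution P p \<longleftrightarrow>
     (\<forall>x. 0 \<le> p x) \<and> (p has_sum 1) UNIV \<and>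
     (\<forall>t\<ge>0. \<forall>y. ((\<lambda>x. p x * P t x y) has_sum p y) UNIV)"

text \<open>
  In the following, \<open>X x\<close> is the process started in state \<open>x\<close>.
\<close>

definition transition_prob ::
  "'w measure \<Rightarrow> ('q \<Rightarrow> real \<Rightarrow> 'w \<Rightarrow> 'q) \<Rightarrow> real \<Rightarrow> 'q \<Rightarrow> 'q \<Rightarrow> real" where
  "transition_prob M X t x y = \<P>(\<omega> in M. X x t \<omega> = y)"

definition irreducible_chain :: "(real \<Rightarrow> 'q \<Rightarrow> 'q \<Rightarrow> real) \<Rightarrow> bool" where
  "irreducible_chain P \<longleftrightarrow> (\<forall>x y. \<exists>t\<ge>0. P t x y > 0)"

text \<open>
  The first time the path is in \<open>x\<close> after having left \<open>x\<close>; infinite if there is none.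
\<close>

definition return_time :: "(real \<Rightarrow> 'w \<Rightarrow> 'q) \<Rightarrow> 'q \<Rightarrow> 'w \<Rightarrow> ennreal" where
  "return_time Y x \<omega> =
     (INF t\<in>{t. 0 \<le> t \<and> Y t \<omega> = x \<and> (\<exists>s. 0 \<le> s \<and> s < t \<and> Y s \<omega> \<noteq> x)}. ennreal t)"

text \<open>
  Every state has a finite mean return time.  (This is the notion for chains without absorbing
  states, such as the matching queue, where every customer arrival changes the state.)
\<close>

definition positive_recurrent :: "'w measure \<Rightarrow> ('q \<Rightarrow> real \<Rightarrow> 'w \<Rightarrow> 'q) \<Rightarrow> bool" where
  "positive_recurrent M X \<longleftrightarrow> (\<forall>x. (\<integral>\<^sup>+\<omega>. return_time (X x) x \<omega> \<partial>M) < \<infinity>)"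

definition ergodic :: "'w measure \<Rightarrow> ('q \<Rightarrow> real \<Rightarrow> 'w \<Rightarrow> 'q) \<Rightarrow> bool" where
  "ergodic M X \<longleftrightarrow> irreducible_chain (transition_prob M X) \<and> positive_recurrent M X"

end

theory Submission
  imports Defs
begin

text \<open>
  The arrivals of all types form a Poisson stream with independent type marks, so the word of the
  arrivals in \<open>{s<..t}\<close> consists of a Poisson number of independent letters and is independent of
  the past.  The queue is the fold of its transition map over this word: it is a discrete chain
  with independent driving letters, run at the jumps of a Poisson process.  In particular its mean
  return times are finite if and only if those of the discrete chain are.

  The product form weight is invariant for the discrete chain by partial balance: the customer
  arrivals balance the servers compatible with some waiting customer, and each term
  \<open>lam c\<close> is balanced by the removals of a customer \<open>c\<close>, a sum that telescopes over
  the positions of the removed customer.  Under the stability condition the weights are summable,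
  and Kac's argument gives finite mean return times.  If \<open>lam\<close> dominates on some set \<open>C\<close>, the
  number of waiting customers with types in \<open>C\<close> is a submartingale that grows by at most one per
  step, whence the probability of not having emptied the queue after \<open>m\<close> steps is at least of order
  \<open>1 / m\<close>, which is not summable.
\<close>

section \<open>Arrival words\<close>

text \<open>The hypotheses describe each stream by its counts alone, so the law of the ordered word
  has to be extracted from them. On a fine grid the outcomes with at most one arrival per cell have
  product probabilities. They give a lower bound for the mass of each word, and these bounds already
  add up to one; hence they are exact, and simultaneous arrivals are negligible without a separate
  argument. Independence of the past is likewise tested on such cell outcomes only
  (\<open>past\<close>). The return time is an infimum over uncountably many times. Instead of being
  shown measurable, it is compared pointwise with sums of indicators of the events "no return by the
  integer time \<open>n\<close>". The lower comparison holds on every path. The upper one needs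
  \<open>resolved\<close>, because a state passed through between two simultaneous arrivals is
  occupied at no time. The stationary law is unique because the kernel at time 1 is strictly
  positive.\<close>

definition letters_at :: "('k::countable \<Rightarrow> real set) \<Rightarrow> real \<Rightarrow> 'k list" where
  "letters_at T \<tau> = map from_nat (sorted_list_of_set (to_nat ` {k. \<tau> \<in> T k}))"

definition word :: "('k::countable \<Rightarrow> real set) \<Rightarrow> real \<Rightarrow> real \<Rightarrow> 'k list" where
  "word T s t = concat (map (letters_at T) (sorted_list_of_set ((\<Union>k. T k) \<inter> {s<..t})))"

definition locally_finite :: "('k \<Rightarrow> real set) \<Rightarrow> bool" where
  "locally_finite T \<longleftrightarrow> (\<forall>k t. finite (T k \<inter> {..t}))"

definition cell :: "('k \<Rightarrow> real set) \<Rightarrow> real \<Rightarrow> real \<Rightarrow> 'k option \<Rightarrow> bool" where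
  "cell T s t v \<longleftrightarrow> (\<forall>k. card (T k \<inter> {s<..t}) = of_bool (v = Some k))"

text \<open>Depends on the streams through counts only, which are the measurable quantities, and
  lists the types in the same order as \<open>letters_at\<close>.\<close>

definition cell_word :: "('k::countable \<Rightarrow> real set) \<Rightarrow> real \<Rightarrow> real \<Rightarrow> 'k list" where
  "cell_word T s t = map from_nat (sorted_list_of_set (to_nat ` {k. card (T k \<inter> {s<..t}) \<noteq> 0}))"

definition grid :: "real \<Rightarrow> real \<Rightarrow> nat \<Rightarrow> nat \<Rightarrow> real" where
  "grid s t n j = s + (t - s) * real j / real n"

text \<open>For locally finite streams and \<open>s \<le> t\<close>, the equidistant grid separates
  all arrivals, so that no two of them coincide.\<close>

definition resolved :: "('k \<Rightarrow> real set) \<Rightarrow> real \<Rightarrow> real \<Rightarrow> nat \<Rightarrow> bool" where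
  "resolved T s t n \<longleftrightarrow> 0 < n \<and> (\<forall>j<n. \<exists>v. cell T (grid s t n j) (grid s t n (Suc j)) v)"

definition letters :: "'k option list \<Rightarrow> 'k list" where
  "letters v = List.map_filter id v"

lemma letters_simps [simp]:
  "letters [] = []" "letters (None # v) = letters v" "letters (Some k # v) = k # letters v"
  by (simp_all add: letters_def map_filter_simps)

lemma letters_append [simp]: "letters (u @ v) = letters u @ letters v"
  by (induction u) (auto simp: letters_def map_filter_simps split: option.split)

lemma arrival_word_eq: "arrival_word A t \<omega> = word (\<lambda>k. A k \<omega>) 0 t"
  by (simp add: arrival_word_def word_def letters_at_def cong: map_cong)

lemma grid_0 [simp]: "grid s t n 0 = s"
  by (simp add: grid_def)

lemma grid_n [simp]: "0 < n \<Longrightarrow> grid s t n n = t"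
  by (simp add: grid_def)

lemma grid_Suc: "grid s t n (Suc j) = grid s t n j + (t - s) / n"
  by (cases "n = 0") (auto simp: grid_def field_simps)

lemma grid_strict_mono: "s < t \<Longrightarrow> 0 < n \<Longrightarrow> i < j \<Longrightarrow> grid s t n i < grid s t n j"
  by (simp add: grid_def divide_strict_right_mono)

lemma grid_mono: "s \<le> t \<Longrightarrow> i \<le> j \<Longrightarrow> grid s t n i \<le> grid s t n j"
  by (simp add: grid_def divide_right_mono mult_left_mono)

lemma locally_finite_epochs:
  fixes T :: "'k::finite \<Rightarrow> real set"
  assumes "locally_finite T"
  shows "finite ((\<Union>k. T k) \<inter> {s<..t})"
proof -
  have "(\<Union>k. T k) \<inter> {s<..t} \<subseteq> (\<Union>k. T k \<inter> {..t})" by auto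
  moreover have "finite (\<Union>k. T k \<inter> {..t})"
    using assms by (intro finite_UN_I) (auto simp: locally_finite_def)
  ultimately show ?thesis by (rule finite_subset)
qed

lemma locally_finite_interval:
  assumes "locally_finite T"
  shows "finite (T k \<inter> {s<..t})"
  by (rule finite_subset[of _ "T k \<inter> {..t}"]) (use assms in \<open>auto simp: locally_finite_def\<close>)

lemma sorted_list_of_set_Un:
  fixes A B :: "'a::linorder set"
  assumes "finite A" "finite B" "\<And>a b. a \<in> A \<Longrightarrow> b \<in> B \<Longrightarrow> a < b"
  shows "sorted_list_of_set (A \<union> B) = sorted_list_of_set A @ sorted_list_of_set B"
proof -
  have "A \<inter> B = {}" using assms(3) by blast
  then show ?thesis
    using assms by (intro sorted_distinct_set_unique) (auto simp: sorted_append intro: less_imp_le)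
qed

lemma word_append:
  fixes T :: "'k::finite \<Rightarrow> real set"
  assumes "locally_finite T" "s \<le> t" "t \<le> u"
  shows "word T s u = word T s t @ word T t u"
proof -
  have "(\<Union>k. T k) \<inter> {s<..u} = (\<Union>k. T k) \<inter> {s<..t} \<union> (\<Union>k. T k) \<inter> {t<..u}"
    using assms by auto
  then show ?thesis
    unfolding word_def by (simp only:) (subst sorted_list_of_set_Un,
      auto simp: locally_finite_epochs[OF assms(1)])
qed

lemma word_refl [simp]: "word T s s = []"
  by (simp add: word_def)

lemma single_epoch_word:
  fixes T :: "'k::finite \<Rightarrow> real set"
  assumes lf: "locally_finite T" and single: "(\<Union>k. T k) \<inter> {s<..t} \<subseteq> {\<tau>}"
  shows "word T s t = cell_word T s t"
proof (cases "(\<Union>k. T k) \<inter> {s<..t} = {}")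
  case True
  then have "T k \<inter> {s<..t} = {}" for k by auto
  then show ?thesis using True by (simp add: word_def cell_word_def)
next
  case False
  then have eq: "(\<Union>k. T k) \<inter> {s<..t} = {\<tau>}" using single by auto
  have "\<tau> \<in> T k \<longleftrightarrow> card (T k \<inter> {s<..t}) \<noteq> 0" for k
  proof -
    have "T k \<inter> {s<..t} \<subseteq> {\<tau>}" "s < \<tau>" "\<tau> \<le> t" using eq by auto
    then have "\<tau> \<in> T k \<longleftrightarrow> T k \<inter> {s<..t} \<noteq> {}" by auto
    then show ?thesis using locally_finite_interval[OF lf, of k s t] by (simp add: card_eq_0_iff)
  qed
  then have "{k. \<tau> \<in> T k} = {k. card (T k \<inter> {s<..t}) \<noteq> 0}" by simp
  then show ?thesis by (simp add: word_def cell_word_def letters_at_def eq)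
qed

lemma cell_imp_word:
  fixes T :: "'k::finite \<Rightarrow> real set"
  assumes lf: "locally_finite T" and cell: "cell T s t v"
  shows "word T s t = letters [v]"
proof -
  have card: "card (T k \<inter> {s<..t}) = of_bool (v = Some k)" for k
    using cell by (simp add: cell_def)
  have empty: "T k \<inter> {s<..t} = {}" if "v \<noteq> Some k" for k
    using card[of k] that locally_finite_interval[OF lf, of k s t] by (simp add: card_eq_0_iff)
  show ?thesis
  proof (cases v)
    case None
    then have "word T s t = cell_word T s t"
      using empty by (intro single_epoch_word[OF lf, where \<tau> = 0]) auto
    then show ?thesis using None card by (simp add: cell_word_def)
  next
    case (Some k)
    obtain \<tau> where \<tau>: "T k \<inter> {s<..t} = {\<tau>}"
      using card[of k] Some by (auto simp: card_1_singleton_iff)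
    have "x = \<tau>" if "x \<in> T k'" "s < x" "x \<le> t" for x k'
    proof (cases "k' = k")
      case True
      then have "x \<in> T k \<inter> {s<..t}" using that by simp
      then show ?thesis unfolding \<tau> by simp
    next
      case False
      then have "T k' \<inter> {s<..t} = {}" using Some by (intro empty) simp
      then show ?thesis using that by auto
    qed
    then have "word T s t = cell_word T s t"
      by (intro single_epoch_word[OF lf, where \<tau> = \<tau>]) auto
    moreover have "{k. card (T k \<inter> {s<..t}) \<noteq> 0} = {k}" using card Some by auto
    ultimately show ?thesis using Some by (simp add: cell_word_def)
  qed
qed

lemma word_grid:
  fixes T :: "'k::finite \<Rightarrow> real set"
  assumes "locally_finite T" "s \<le> t"
  shows "word T s (grid s t n j) = concat (map (\<lambda>i. word T (grid s t n i) (grid s t n (Suc i))) [0..<j])"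
proof (induction j)
  case (Suc j)
  have "s \<le> grid s t n j" using grid_mono[OF assms(2), of 0 j n] by simp
  then have "word T s (grid s t n (Suc j)) =
      word T s (grid s t n j) @ word T (grid s t n j) (grid s t n (Suc j))"
    by (intro word_append assms grid_mono) auto
  then show ?case using Suc by simp
qed simp

lemma cells_imp_word:
  fixes T :: "'k::finite \<Rightarrow> real set"
  assumes lf: "locally_finite T" and "s \<le> t" "0 < length v"
    and cells: "\<And>j. j < length v \<Longrightarrow> cell T (grid s t (length v) j) (grid s t (length v) (Suc j)) (v ! j)"
  shows "word T s t = letters v"
proof -
  have "word T s (grid s t (length v) j) = letters (take j v)" if "j \<le> length v" for j
    using that
  proof (induction j)
    case (Suc j)
    have "word T s (grid s t (length v) (Suc j)) =
        word T s (grid s t (length v) j) @ word T (grid s t (length v) j) (grid s t (length v) (Suc j))"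
      using word_grid[OF lf assms(2), of "length v"] by simp
    then show ?case
      using Suc cell_imp_word[OF lf cells[of j]] by (simp add: take_Suc_conv_app_nth)
  qed simp
  from this[of "length v"] show ?thesis using assms by simp
qed

section \<open>Recovering the word from counts on fine grids\<close>

lemma finite_separated:
  fixes F :: "real set"
  assumes "finite F"
  shows "\<exists>\<delta>>0. \<forall>x\<in>F. \<forall>y\<in>F. x \<noteq> y \<longrightarrow> \<delta> \<le> \<bar>x - y\<bar>"
proof -
  let ?D = "insert 1 ((\<lambda>(x, y). \<bar>x - y\<bar>) ` {(x, y) \<in> F \<times> F. x \<noteq> y})"
  have fin: "finite ?D"
  proof -
    have "finite {(x, y) \<in> F \<times> F. x \<noteq> y}"
      by (rule finite_subset[of _ "F \<times> F"]) (use assms in auto)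
    then show ?thesis by simp
  qed
  then have "0 < Min ?D" by (subst Min_gr_iff) auto
  moreover have "Min ?D \<le> \<bar>x - y\<bar>" if "x \<in> F" "y \<in> F" "x \<noteq> y" for x y
    using fin that by (intro Min_le) auto
  ultimately show ?thesis by blast
qed

definition approx_word :: "('k::countable \<Rightarrow> real set) \<Rightarrow> real \<Rightarrow> real \<Rightarrow> nat \<Rightarrow> 'k list" where
  "approx_word T s t n = concat (map (\<lambda>j. cell_word T (grid s t n j) (grid s t n (Suc j))) [0..<n])"

text \<open>Once the mesh is below the smallest gap between epochs, every cell holds at most one
  epoch. Several types arriving at that epoch do no harm, since \<open>cell_word\<close> and
  \<open>word\<close> order them alike.\<close>

lemma eventually_approx_word:
  fixes T :: "'k::finite \<Rightarrow> real set"
  assumes lf: "locally_finite T" and st: "s \<le> t"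
  shows "\<forall>\<^sub>F n in sequentially. approx_word T s t n = word T s t"
proof -
  obtain \<delta> where \<delta>: "0 < \<delta>" "\<And>x y. x \<in> (\<Union>k. T k) \<inter> {s<..t} \<Longrightarrow> y \<in> (\<Union>k. T k) \<inter> {s<..t} \<Longrightarrow>
      x \<noteq> y \<Longrightarrow> \<delta> \<le> \<bar>x - y\<bar>"
    using finite_separated[OF locally_finite_epochs[OF lf]] by metis
  have "\<forall>\<^sub>F n in sequentially. (t - s) / \<delta> < real n" by real_asymp
  moreover have "\<forall>\<^sub>F n in sequentially. 0 < (n :: nat)" by (rule eventually_gt_at_top)
  ultimately show ?thesis
  proof eventually_elim
    case (elim n)
    have mesh: "(t - s) / n < \<delta>" using elim \<delta> by (simp add: field_simps)
    have "word T (grid s t n j) (grid s t n (Suc j)) = cell_word T (grid s t n j) (grid s t n (Suc j))"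
      if "j < n" for j
    proof -
      let ?F = "(\<Union>k. T k) \<inter> {grid s t n j<..grid s t n (Suc j)}"
      have sub: "{grid s t n j<..grid s t n (Suc j)} \<subseteq> {s<..t}"
        using grid_mono[OF st, of 0 j n] grid_mono[OF st, of "Suc j" n n] elim that by auto
      have "x = y" if "x \<in> ?F" "y \<in> ?F" for x y
      proof (rule ccontr)
        assume "x \<noteq> y"
        then have "\<delta> \<le> \<bar>x - y\<bar>" using that sub by (intro \<delta>(2)) auto
        moreover have "\<bar>x - y\<bar> \<le> (t - s) / n" using that by (auto simp: grid_Suc)
        ultimately show False using mesh by simp
      qed
      then have "\<exists>\<tau>. ?F \<subseteq> {\<tau>}" by blast
      then show ?thesis using single_epoch_word[OF lf] by blast
    qed
    then have "approx_word T s t n = word T s (grid s t n n)"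
      unfolding approx_word_def word_grid[OF lf st] by (intro arg_cong[where f=concat] map_cong) auto
    then show ?case using elim by simp
  qed
qed

text \<open>Expresses an event about \<open>word\<close> by countably many events about grid counts,
  which makes \<open>word\<close> measurable.\<close>

lemma word_eq_iff:
  fixes T :: "'k::finite \<Rightarrow> real set"
  assumes "locally_finite T" "s \<le> t"
  shows "word T s t = w \<longleftrightarrow> (\<exists>N. \<forall>n\<ge>N. approx_word T s t n = w)"
proof -
  obtain N where N: "\<forall>n\<ge>N. approx_word T s t n = word T s t"
    using eventually_approx_word[OF assms] unfolding eventually_sequentially by blast
  then have "w = word T s t" if "\<forall>n\<ge>N'. approx_word T s t n = w" for N'
    using that[rule_format, of "max N N'"] by simp
  with N show ?thesis by blast
qed

text \<open>Each cell adds at most one letter, so along the grid the length of the word skips no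
  value. At the first grid time where it reaches \<open>length u\<close> it equals
  \<open>length u\<close>, and the word read so far is \<open>u\<close>.\<close>

lemma resolved_prefix:
  fixes T :: "'k::finite \<Rightarrow> real set"
  assumes lf: "locally_finite T" and st: "s \<le> t" and resolved: "resolved T s t n" and w: "word T s t = u @ z"
  shows "\<exists>\<tau>\<in>{s..t}. word T s \<tau> = u"
proof -
  have n: "0 < n" using resolved by (simp add: resolved_def)
  let ?W = "\<lambda>j. word T s (grid s t n j)"
  define j where "j = (LEAST j. length u \<le> length (?W j))"
  have ex: "length u \<le> length (?W n)" using w n by simp
  then have j: "length u \<le> length (?W j)" "j \<le> n"
    unfolding j_def by (auto intro: LeastI Least_le)
  have len: "length (?W j) = length u"
  proof (cases j)
    case 0
    then show ?thesis using j by simp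
  next
    case (Suc i)
    then have "i < n" using j by simp
    have "\<not> length u \<le> length (?W i)"
      using Suc unfolding j_def by (intro not_less_Least) simp
    moreover obtain v where "cell T (grid s t n i) (grid s t n (Suc i)) v"
      using resolved \<open>i < n\<close> unfolding resolved_def by blast
    then have "length (word T (grid s t n i) (grid s t n (Suc i))) \<le> 1"
      by (cases v) (auto simp: cell_imp_word[OF lf])
    moreover have "?W j = ?W i @ word T (grid s t n i) (grid s t n (Suc i))"
      using word_grid[OF lf st] Suc by simp
    ultimately show ?thesis using j by simp
  qed
  have g: "s \<le> grid s t n j" "grid s t n j \<le> t"
    using grid_mono[OF st, of 0 j n] grid_mono[OF st, of j n n] j n by auto
  then have "?W j @ word T (grid s t n j) t = u @ z"
    using word_append[OF lf, of s "grid s t n j" t] w by simp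
  then have "?W j = u" using len by simp
  then show ?thesis using g by auto
qed

section \<open>Return times of chains driven by independent letters\<close>

lemma has_sum_iff_nn_integral:
  fixes f :: "'a \<Rightarrow> real"
  assumes f: "\<And>x. 0 \<le> f x" and S: "0 \<le> S"
  shows "(f has_sum S) UNIV \<longleftrightarrow> (\<integral>\<^sup>+x. ennreal (f x) \<partial>count_space UNIV) = ennreal S"
proof -
  have *: "(\<integral>\<^sup>+x. ennreal (f x) \<partial>count_space UNIV) = ennreal (infsum f UNIV)"
    if "f summable_on UNIV"
  proof -
    have "Infinite_Set_Sum.abs_summable_on f UNIV"
      using that f by (simp add: abs_summable_equivalent[symmetric])
    then show ?thesis
      using f nn_integral_conv_infsetsum[of f UNIV] infsetsum_infsum[of f UNIV] by simp
  qed
  have "f summable_on UNIV" if "(\<integral>\<^sup>+x. ennreal (f x) \<partial>count_space UNIV) = ennreal S"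
  proof -
    have "Infinite_Set_Sum.abs_summable_on f UNIV"
      using that f unfolding abs_summable_on_def
      by (intro integrableI_nonneg) auto
    then show ?thesis
      using f by (simp add: abs_summable_equivalent[symmetric])
  qed
  with * show ?thesis
    using f S by (auto simp: has_sum_iff infsum_nonneg)
qed

lemma has_sum_pmf: "(pmf p has_sum 1) UNIV"
proof -
  have "(\<integral>\<^sup>+x. ennreal (pmf p x) \<partial>count_space UNIV) = 1"
    using nn_integral_measure_pmf[of p "\<lambda>_. 1"] measure_pmf.emeasure_space_1[of p] by simp
  then show ?thesis by (simp add: has_sum_iff_nn_integral)
qed

lemma has_sum_bind_pmf: "((\<lambda>x. pmf p x * pmf (f x) y) has_sum pmf (bind_pmf p f) y) UNIV"
  by (subst has_sum_iff_nn_integral)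
    (auto simp: ennreal_pmf_bind nn_integral_measure_pmf ennreal_mult)

lemma pmf_replicate_pmf:
  "pmf (replicate_pmf n p) w = (if length w = n then prod_list (map (pmf p) w) else 0)"
proof (induction n arbitrary: w)
  case 0
  then show ?case by (auto simp: indicator_def)
next
  case (Suc n)
  have eq: "replicate_pmf (Suc n) p = map_pmf (\<lambda>(x, xs). x # xs) (pair_pmf p (replicate_pmf n p))"
    by (simp add: map_pmf_def pair_pmf_def bind_assoc_pmf bind_return_pmf)
  show ?case
  proof (cases w)
    case Nil
    have "[] \<notin> set_pmf (replicate_pmf (Suc n) p)"
      by (auto simp: set_replicate_pmf)
    then show ?thesis using Nil by (simp add: set_pmf_iff del: replicate_pmf.simps)
  next
    case (Cons a v)
    have "pmf (map_pmf (\<lambda>(x, xs). x # xs) (pair_pmf p (replicate_pmf n p))) ((\<lambda>(x, xs). x # xs) (a, v)) =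
      pmf (pair_pmf p (replicate_pmf n p)) (a, v)"
      by (rule pmf_map_inj') (auto simp: inj_def)
    then show ?thesis using Suc Cons eq by (simp add: pmf_pair)
  qed
qed

definition letter_pmf :: "('k::finite \<Rightarrow> real) \<Rightarrow> 'k pmf" where
  "letter_pmf r = embed_pmf (\<lambda>k. r k / sum r UNIV)"

lemma pmf_letter_pmf:
  assumes "\<And>k. 0 < r k"
  shows "pmf (letter_pmf r) k = r k / sum r UNIV"
  unfolding letter_pmf_def
proof (rule pmf_embed_pmf)
  have pos: "0 < sum r UNIV" using assms by (intro sum_pos) auto
  then show "0 \<le> r k / sum r UNIV" for k using assms[of k] by simp
  then have "(\<integral>\<^sup>+k. ennreal (r k / sum r UNIV) \<partial>count_space UNIV) = ennreal (\<Sum>k\<in>UNIV. r k / sum r UNIV)"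
    by (subst nn_integral_count_space_finite) (auto intro!: sum_ennreal)
  then show "(\<integral>\<^sup>+k. ennreal (r k / sum r UNIV) \<partial>count_space UNIV) = 1"
    using pos by (simp flip: sum_divide_distrib)
qed

section \<open>Avoiding a state and returning to it\<close>

text \<open>The starting state \<open>y\<close> itself is not required to differ from \<open>x\<close>.\<close>

fun avoids :: "('k \<Rightarrow> 'q \<Rightarrow> 'q) \<Rightarrow> 'q \<Rightarrow> 'q \<Rightarrow> 'k list \<Rightarrow> bool" where
  "avoids f x y [] = True"
| "avoids f x y (k # w) = (f k y \<noteq> x \<and> avoids f x (f k y) w)"

text \<open>Letters that keep the state at \<open>x\<close> start no excursion, in accordance with
  \<open>return_time\<close>, which asks for a departure first. In the queue, a server who finds
  nobody compatible is such a letter.\<close>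

fun no_return :: "('k \<Rightarrow> 'q \<Rightarrow> 'q) \<Rightarrow> 'q \<Rightarrow> 'k list \<Rightarrow> bool" where
  "no_return f x [] = True"
| "no_return f x (k # w) = (if f k x = x then no_return f x w else avoids f x (f k x) w)"

lemma avoids_iff: "avoids f x y w \<longleftrightarrow> (\<forall>u v. w = u @ v \<and> u \<noteq> [] \<longrightarrow> fold f u y \<noteq> x)"
proof (induction w arbitrary: y)
  case (Cons k w)
  show ?case
  proof
    assume L: "avoids f x y (k # w)"
    show "\<forall>u v. k # w = u @ v \<and> u \<noteq> [] \<longrightarrow> fold f u y \<noteq> x"
    proof safe
      fix u v assume "k # w = u @ v" "u \<noteq> []" "x = fold f u y"
      then obtain u' where "u = k # u'" "w = u' @ v" by (cases u) auto
      with L Cons.IH[of "f k y"] \<open>x = fold f u y\<close> show False by (cases "u' = []") auto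
    qed
  next
    assume R: "\<forall>u v. k # w = u @ v \<and> u \<noteq> [] \<longrightarrow> fold f u y \<noteq> x"
    have "f k y \<noteq> x" using R[rule_format, of "[k]" w] by simp
    moreover have "avoids f x (f k y) w"
      unfolding Cons.IH using R[rule_format, of "k # _"] by auto
    ultimately show "avoids f x y (k # w)" by simp
  qed
qed simp

text \<open>The form that matches \<open>return_time\<close>: \<open>u\<close> is the word at a time
  away from \<open>x\<close>, and \<open>u @ v\<close> the word at a later time.\<close>

lemma no_return_iff:
  "no_return f x w \<longleftrightarrow>
    (\<forall>u v z. w = u @ v @ z \<and> v \<noteq> [] \<and> fold f u x \<noteq> x \<longrightarrow> fold f (u @ v) x \<noteq> x)"
proof (induction w)
  case (Cons k w)
  show ?case
  proof (cases "f k x = x")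
    case True
    have "(\<forall>u v z. k # w = u @ v @ z \<and> v \<noteq> [] \<and> fold f u x \<noteq> x \<longrightarrow> fold f (u @ v) x \<noteq> x) \<longleftrightarrow>
      (\<forall>u v z. w = u @ v @ z \<and> v \<noteq> [] \<and> fold f u x \<noteq> x \<longrightarrow> fold f (u @ v) x \<noteq> x)"
      (is "?L \<longleftrightarrow> ?R")
    proof
      assume L: ?L
      show ?R
      proof (intro allI impI)
        fix u v z assume "w = u @ v @ z \<and> v \<noteq> [] \<and> fold f u x \<noteq> x"
        then show "fold f (u @ v) x \<noteq> x" using L[rule_format, of "k # u" v z] True by simp
      qed
    next
      assume R: ?R
      show ?L
      proof (intro allI impI)
        fix u v z assume *: "k # w = u @ v @ z \<and> v \<noteq> [] \<and> fold f u x \<noteq> x"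
        then obtain u' where "u = k # u'" by (cases u) auto
        then show "fold f (u @ v) x \<noteq> x" using * R[rule_format, of u' v z] True by simp
      qed
    qed
    then show ?thesis using True Cons.IH by simp
  next
    case False
    have "avoids f x (f k x) w \<longleftrightarrow>
      (\<forall>u v z. k # w = u @ v @ z \<and> v \<noteq> [] \<and> fold f u x \<noteq> x \<longrightarrow> fold f (u @ v) x \<noteq> x)"
      (is "?L \<longleftrightarrow> ?R")
    proof
      assume L: ?L
      show ?R
      proof (intro allI impI)
        fix u v z assume *: "k # w = u @ v @ z \<and> v \<noteq> [] \<and> fold f u x \<noteq> x"
        then obtain u' where "u = k # u'" by (cases u) auto
        then show "fold f (u @ v) x \<noteq> x"
          using * L[unfolded avoids_iff, rule_format, of "u' @ v" z] by simp
      qed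
    next
      assume R: ?R
      show ?L unfolding avoids_iff
      proof (intro allI impI)
        fix u v assume "w = u @ v \<and> u \<noteq> []"
        then show "fold f u (f k x) \<noteq> x"
          using R[rule_format, of "[k]" u v] False by simp
      qed
    qed
    then show ?thesis using False by simp
  qed
qed simp

lemma emeasure_replicate_pmf_Suc:
  "emeasure (replicate_pmf (Suc n) p) A = (\<integral>\<^sup>+k. emeasure (replicate_pmf n p) {w. k # w \<in> A} \<partial>p)"
  by (simp add: map_pmf_def[symmetric] vimage_def)

lemma prob_replicate_pmf_Suc:
  fixes p :: "'k::finite pmf"
  shows "measure_pmf.prob (replicate_pmf (Suc n) p) A =
    (\<Sum>k\<in>UNIV. pmf p k * measure_pmf.prob (replicate_pmf n p) {w. k # w \<in> A})"
proof -
  have "ennreal (measure_pmf.prob (replicate_pmf (Suc n) p) A) =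
      (\<Sum>k\<in>UNIV. ennreal (pmf p k) * ennreal (measure_pmf.prob (replicate_pmf n p) {w. k # w \<in> A}))"
    unfolding measure_pmf.emeasure_eq_measure[symmetric] emeasure_replicate_pmf_Suc
    by (simp add: nn_integral_measure_pmf nn_integral_count_space_finite)
  also have "\<dots> = ennreal (\<Sum>k\<in>UNIV. pmf p k * measure_pmf.prob (replicate_pmf n p) {w. k # w \<in> A})"
    by (simp flip: ennreal_mult add: sum_ennreal)
  finally show ?thesis
    by (subst (asm) ennreal_inj) (auto intro!: sum_nonneg)
qed

abbreviation avoid_prob :: "('k \<Rightarrow> 'q \<Rightarrow> 'q) \<Rightarrow> 'k pmf \<Rightarrow> 'q \<Rightarrow> nat \<Rightarrow> 'q \<Rightarrow> real" where
  "avoid_prob f p x m y \<equiv> measure_pmf.prob (replicate_pmf m p) {w. avoids f x y w}"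

abbreviation no_return_prob :: "('k \<Rightarrow> 'q \<Rightarrow> 'q) \<Rightarrow> 'k pmf \<Rightarrow> 'q \<Rightarrow> nat \<Rightarrow> real" where
  "no_return_prob f p x m \<equiv> measure_pmf.prob (replicate_pmf m p) {w. no_return f x w}"

lemma avoid_prob_Suc:
  fixes p :: "'k::finite pmf"
  shows "avoid_prob f p x (Suc m) y =
    (\<Sum>k\<in>UNIV. pmf p k * (if f k y = x then 0 else avoid_prob f p x m (f k y)))"
  unfolding prob_replicate_pmf_Suc by (intro sum.cong) auto

lemma no_return_prob_Suc:
  fixes p :: "'k::finite pmf"
  shows "no_return_prob f p x (Suc m) =
    (\<Sum>k\<in>UNIV. pmf p k *
      (if f k x = x then no_return_prob f p x m else avoid_prob f p x m (f k x)))"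
  unfolding prob_replicate_pmf_Suc by (intro sum.cong) auto

text \<open>
  Kac's argument: by stationarity the probability of avoiding \<open>x\<close> at the times \<open>1, \<dots>, m + 1\<close>
  equals that of avoiding \<open>x\<close> at the times \<open>0, \<dots>, m\<close>, so the terms below telescope.
\<close>

lemma kac_bound:
  fixes p :: "'k::finite pmf"
  assumes stat: "bind_pmf P (\<lambda>y. map_pmf (\<lambda>k. f k y) p) = P"
  shows "pmf P x * (\<Sum>m<N. avoid_prob f p x (Suc m) x) \<le> 1"
proof -
  define H where "H m y = emeasure (replicate_pmf m p) {w. avoids f x y w}" for m y
  define b where "b m = (\<integral>\<^sup>+y. (if y = x then 0 else H m y) \<partial>P)" for m
  have HSuc: "H (Suc m) y = (\<integral>\<^sup>+k. (if f k y = x then 0 else H m (f k y)) \<partial>p)" for m y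
    unfolding H_def emeasure_replicate_pmf_Suc by (intro nn_integral_cong) auto
  have 1: "(\<integral>\<^sup>+y. H (Suc m) y \<partial>P) = b m" for m
    unfolding HSuc b_def by (subst (2) stat[symmetric]) simp
  have 2: "(\<integral>\<^sup>+y. H (Suc m) y \<partial>P) = b (Suc m) + H (Suc m) x * pmf P x" for m
  proof -
    have "(\<integral>\<^sup>+y. H (Suc m) y \<partial>P) =
        (\<integral>\<^sup>+y. (if y = x then 0 else H (Suc m) y) + H (Suc m) x * indicator {x} y \<partial>P)"
      by (intro nn_integral_cong) (auto simp: indicator_def)
    also have "\<dots> = b (Suc m) + H (Suc m) x * pmf P x"
      unfolding b_def by (subst nn_integral_add) (auto simp: nn_integral_cmult emeasure_pmf_single)
    finally show ?thesis .
  qed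
  have tele: "b N + (\<Sum>m<N. H (Suc m) x * pmf P x) = b 0" for N
  proof (induction N)
    case (Suc N)
    have "b (Suc N) + (\<Sum>m<Suc N. H (Suc m) x * pmf P x) =
        (b (Suc N) + H (Suc N) x * pmf P x) + (\<Sum>m<N. H (Suc m) x * pmf P x)"
      by (simp add: add_ac)
    also have "b (Suc N) + H (Suc N) x * pmf P x = b N" using 1[of N] 2[of N] by simp
    finally show ?case using Suc by simp
  qed simp
  have "b 0 \<le> (\<integral>\<^sup>+y. 1 \<partial>P)"
    unfolding b_def by (intro nn_integral_mono) (auto simp: H_def measure_pmf.emeasure_le_1)
  also have "\<dots> = 1" using measure_pmf.emeasure_space_1[of P] by simp
  finally have "b 0 \<le> 1" .
  have "(\<Sum>m<N. H (Suc m) x * pmf P x) \<le> b N + (\<Sum>m<N. H (Suc m) x * pmf P x)" by simp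
  also have "\<dots> \<le> 1" using tele[of N] \<open>b 0 \<le> 1\<close> by simp
  also have "(\<Sum>m<N. H (Suc m) x * pmf P x) = ennreal (\<Sum>m<N. avoid_prob f p x (Suc m) x * pmf P x)"
    unfolding H_def measure_pmf.emeasure_eq_measure
    by (subst sum_ennreal[symmetric]) (auto simp: ennreal_mult)
  finally show ?thesis
    by (simp add: sum_distrib_left mult_ac)
qed

text \<open>A path without return stays at \<open>x\<close> for a while and then avoids it. With
  \<open>\<theta>\<close> the probability of staying for one step this is the recursion
  \<open>rec\<close>; the avoiding part is summable by \<open>kac_bound\<close>, and the letter
  \<open>k\<close> ensures \<open>\<theta> < 1\<close>.\<close>

lemma sum_no_return_prob_bounded:
  fixes p :: "'k::finite pmf"
  assumes stat: "bind_pmf P (\<lambda>y. map_pmf (\<lambda>k. f k y) p) = P"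
    and x: "0 < pmf P x" and k: "0 < pmf p k" "f k x \<noteq> x"
  shows "\<exists>B. \<forall>N. (\<Sum>m<N. no_return_prob f p x m) \<le> B"
proof -
  define \<theta> where "\<theta> = (\<Sum>k\<in>UNIV. pmf p k * of_bool (f k x = x))"
  have "(\<Sum>k\<in>UNIV. pmf p k) = 1"
    by (rule sum_pmf_eq_1) auto
  moreover have "\<theta> < (\<Sum>k\<in>UNIV. pmf p k)"
    unfolding \<theta>_def using k by (intro sum_strict_mono_ex1) (auto intro!: bexI[of _ k])
  ultimately have \<theta>: "\<theta> < 1" by simp
  have \<theta>0: "0 \<le> \<theta>" unfolding \<theta>_def by (intro sum_nonneg) auto
  have rec: "no_return_prob f p x (Suc m) = \<theta> * no_return_prob f p x m + avoid_prob f p x (Suc m) x" for m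
    unfolding no_return_prob_Suc avoid_prob_Suc \<theta>_def sum_distrib_right sum.distrib[symmetric]
    by (intro sum.cong) auto
  define S where "S = 1 / pmf P x"
  have S: "(\<Sum>m<N. avoid_prob f p x (Suc m) x) \<le> S" for N
    using kac_bound[OF stat, of x N] x unfolding S_def by (simp add: field_simps)
  have S0: "0 \<le> S" unfolding S_def by simp
  \<comment> \<open>The bound is the fixed point of
    \<open>b = 1 + (\<theta> * b + S)\<close>.\<close>
  have "(\<Sum>m<N. no_return_prob f p x m) \<le> (1 + S) / (1 - \<theta>)" for N
  proof (induction N)
    case 0
    then show ?case using \<theta> S0 by simp
  next
    case (Suc N)
    have "(\<Sum>m<Suc N. no_return_prob f p x m) =
        1 + (\<Sum>m<N. no_return_prob f p x (Suc m))"
      by (subst sum.lessThan_Suc_shift) simp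
    also have "\<dots> = 1 + (\<theta> * (\<Sum>m<N. no_return_prob f p x m) + (\<Sum>m<N. avoid_prob f p x (Suc m) x))"
      unfolding rec by (simp add: sum.distrib sum_distrib_left)
    also have "\<dots> \<le> 1 + (\<theta> * ((1 + S) / (1 - \<theta>)) + S)"
      using Suc \<theta>0 S[of N] by (intro add_mono mult_left_mono) auto
    also have "\<dots> = (1 + S) / (1 - \<theta>)" using \<theta> by (simp add: field_simps)
    finally show ?case .
  qed
  then show ?thesis by blast
qed

section \<open>Uniqueness of the stationary law of a strictly positive kernel\<close>

lemma has_sum_prob_bind_pmf:
  "((\<lambda>x. pmf p x * measure_pmf.prob (f x) G) has_sum measure_pmf.prob (bind_pmf p f) G) UNIV"
proof (subst has_sum_iff_nn_integral)
  have "(\<integral>\<^sup>+x. ennreal (pmf p x * measure_pmf.prob (f x) G) \<partial>count_space UNIV) =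
      emeasure (bind_pmf p f) G"
    unfolding emeasure_bind_pmf nn_integral_measure_pmf
    by (simp add: measure_pmf.emeasure_eq_measure ennreal_mult)
  then show "(\<integral>\<^sup>+x. ennreal (pmf p x * measure_pmf.prob (f x) G) \<partial>count_space UNIV) =
      ennreal (measure_pmf.prob (bind_pmf p f) G)"
    by (simp add: measure_pmf.emeasure_eq_measure)
qed auto

text \<open>
  A strictly positive kernel contracts the mass of \<open>p - p'\<close> on the set where \<open>p > p'\<close>.
\<close>

lemma stationary_pmf_unique:
  assumes p: "bind_pmf p f = p" and p': "bind_pmf p' f = p'"
    and pos: "\<And>x y. 0 < pmf (f x) y"
  shows "p = p'"
proof (rule ccontr)
  assume "p \<noteq> p'"
  then obtain x z where x: "pmf p' x < pmf p x" and z: "pmf p z < pmf p' z"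
    by (metis pmf_neq_exists_less)
  define G where "G = {y. pmf p' y < pmf p y}"
  define g where "g y = measure_pmf.prob (f y) G" for y
  have g: "0 \<le> g y" "g y < 1" for y
  proof -
    \<comment> \<open>Every row of the kernel charges \<open>z\<close>, which lies outside
      \<open>G\<close>.\<close>
    have "g y \<le> measure_pmf.prob (f y) (UNIV - {z})"
      unfolding g_def using z by (intro measure_pmf.finite_measure_mono) (auto simp: G_def)
    also have "\<dots> = 1 - pmf (f y) z"
      using measure_pmf.prob_compl[of "{z}" "f y"] by (simp add: measure_pmf_single)
    finally show "g y < 1" using pos[of y z] by simp
  qed (simp add: g_def)
  have ind: "((\<lambda>y. pmf q y * indicator G y) has_sum measure_pmf.prob q G) UNIV" for q
    using has_sum_prob_bind_pmf[of q return_pmf G] by (simp add: bind_return_pmf')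
  have 1: "((\<lambda>y. (pmf p y - pmf p' y) * g y) has_sum
      (measure_pmf.prob p G - measure_pmf.prob p' G)) UNIV"
    using has_sum_add[OF has_sum_prob_bind_pmf[of p f G]
      has_sum_uminusI[OF has_sum_prob_bind_pmf[of p' f G]]]
    unfolding p p' g_def by (simp add: left_diff_distrib)
  have 2: "((\<lambda>y. (pmf p y - pmf p' y) * indicator G y) has_sum
      (measure_pmf.prob p G - measure_pmf.prob p' G)) UNIV"
    using has_sum_add[OF ind[of p] has_sum_uminusI[OF ind[of p']]] by (simp add: left_diff_distrib)
  have "measure_pmf.prob p G - measure_pmf.prob p' G < measure_pmf.prob p G - measure_pmf.prob p' G"
  proof (rule has_sum_strict_mono[OF 1 2])
    show "(pmf p y - pmf p' y) * g y \<le> (pmf p y - pmf p' y) * indicator G y" for y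
      using g[of y] by (cases "y \<in> G") (auto simp: G_def mult_le_0_iff mult_left_le)
    show "(pmf p x - pmf p' x) * g x < (pmf p x - pmf p' x) * indicator G x"
      using g[of x] x by (simp add: G_def)
  qed simp
  then show False by simp
qed

text \<open>Dividing by \<open>m + 1\<close> shifts the Poisson weights by one and costs a factor
  \<open>a\<close>; what remains is the mass off 0. Thus a bound of order \<open>1 / m\<close> after
  \<open>m\<close> letters becomes one of order \<open>1 / t\<close> at time
  \<open>t\<close>.\<close>

lemma nn_integral_poisson_inverse_Suc:
  assumes a: "0 < a" and \<kappa>: "0 \<le> \<kappa>"
  shows "(\<integral>\<^sup>+m. ennreal (\<kappa> / (real m + 1)) \<partial>poisson_pmf a) = ennreal (\<kappa> * (1 - exp (- a)) / a)"
proof -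
  have "(\<integral>\<^sup>+m. ennreal (\<kappa> / (real m + 1)) \<partial>poisson_pmf a) =
      (\<integral>\<^sup>+m. ennreal (\<kappa> / a) * ennreal (pmf (poisson_pmf a) (Suc m)) \<partial>count_space UNIV)"
    unfolding nn_integral_measure_pmf
  proof (intro nn_integral_cong)
    fix m
    have "pmf (poisson_pmf a) m * (\<kappa> / (real m + 1)) = \<kappa> / a * pmf (poisson_pmf a) (Suc m)"
      using a by (simp add: field_simps)
    then show "ennreal (pmf (poisson_pmf a) m) * ennreal (\<kappa> / (real m + 1)) =
        ennreal (\<kappa> / a) * ennreal (pmf (poisson_pmf a) (Suc m))"
      using a \<kappa> by (simp add: ennreal_mult[symmetric] del: pmf_poisson)
  qed
  also have "\<dots> = ennreal (\<kappa> / a) * emeasure (poisson_pmf a) (range Suc)"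
    by (subst nn_integral_cmult) (auto simp: nn_integral_pmf')
  also have "range Suc = UNIV - {0}" by (auto simp: image_iff) (metis not0_implies_Suc)
  also have "emeasure (poisson_pmf a) (UNIV - {0}) = ennreal (1 - exp (- a))"
    using measure_pmf.prob_compl[of "{0}" "poisson_pmf a"] a
    by (simp add: measure_pmf.emeasure_eq_measure measure_pmf_single)
  finally show ?thesis using a \<kappa> by (simp add: ennreal_mult[symmetric])
qed

text \<open>
  On \<open>{n<..n + 1}\<close> the Erlang density of shape \<open>m\<close> is at least \<open>a * exp (- a)\<close> times the Poisson
  probability of \<open>m\<close> with parameter \<open>a * n\<close>.
\<close>

lemma suminf_poisson_le:
  assumes a: "0 < a"
  shows "(\<Sum>n. ennreal (pmf (poisson_pmf (a * real (Suc n))) m)) \<le> ennreal (exp a / a)"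
proof -
  let ?I = "\<lambda>n. {real (Suc n)<..real (Suc n) + 1}"
  have total: "(\<integral>\<^sup>+t. ennreal (erlang_density m a t) \<partial>lborel) = 1"
    using prob_space.emeasure_space_1[OF prob_space_erlang_density[OF a, of m]]
    by (simp add: emeasure_density)
  have "ennreal (a * exp (- a)) * ennreal (pmf (poisson_pmf (a * real (Suc n))) m) \<le>
      (\<integral>\<^sup>+t. ennreal (erlang_density m a t) * indicator (?I n) t \<partial>lborel)" for n
  proof -
    have "ennreal (a * exp (- a)) * ennreal (pmf (poisson_pmf (a * real (Suc n))) m) =
      ennreal (a * exp (- a) * pmf (poisson_pmf (a * real (Suc n))) m)"
      using a by (simp add: ennreal_mult del: pmf_poisson)
    also have "\<dots> = (\<integral>\<^sup>+t. ennreal (a * exp (- a) * pmf (poisson_pmf (a * real (Suc n))) m) *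
        indicator (?I n) t \<partial>lborel)"
      by (subst nn_integral_cmult_indicator) auto
    also have "\<dots> \<le> (\<integral>\<^sup>+t. ennreal (erlang_density m a t) * indicator (?I n) t \<partial>lborel)"
    proof (intro nn_integral_mono)
      fix t :: real
      show "ennreal (a * exp (- a) * pmf (poisson_pmf (a * real (Suc n))) m) * indicator (?I n) t \<le>
        ennreal (erlang_density m a t) * indicator (?I n) t"
      proof (cases "t \<in> ?I n")
        case True
        then have t: "real (Suc n) \<le> t" "t \<le> real (Suc n) + 1" "0 \<le> t" by auto
        have "exp (- a) * (real (Suc n) ^ m * exp (- (a * real (Suc n)))) =
            real (Suc n) ^ m * exp (- (a * (real (Suc n) + 1)))"
        proof -
          have "exp (- a) * exp (- (a * real (Suc n))) = exp (- (a * (real (Suc n) + 1)))"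
            by (simp add: mult_exp_exp distrib_left)
          then show ?thesis by (simp only: mult.left_commute[of "exp (- a)"])
        qed
        \<comment> \<open>On \<open>?I n\<close> the power is smallest at the left end and the
          exponential at the right end; the unit length of the interval accounts for the factor
          \<open>exp (- a)\<close>.\<close>
        also have "\<dots> \<le> t ^ m * exp (- (a * t))"
          using t a by (intro mult_mono power_mono) auto
        finally have "exp (- a) * (real (Suc n) ^ m * exp (- (a * real (Suc n)))) \<le> t ^ m * exp (- (a * t))" .
        then have "a * a ^ m / fact m * (exp (- a) * (real (Suc n) ^ m * exp (- (a * real (Suc n))))) \<le>
            a * a ^ m / fact m * (t ^ m * exp (- (a * t)))"
          using a by (intro mult_left_mono) auto
        then have "a * exp (- a) * pmf (poisson_pmf (a * real (Suc n))) m \<le> erlang_density m a t"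
          using t a by (simp add: erlang_density_def power_mult_distrib mult_ac)
        then show ?thesis using True by (simp add: ennreal_leI)
      qed simp
    qed
    finally show ?thesis .
  qed
  then have "(\<Sum>n. ennreal (a * exp (- a)) * ennreal (pmf (poisson_pmf (a * real (Suc n))) m)) \<le>
      (\<Sum>n. \<integral>\<^sup>+t. ennreal (erlang_density m a t) * indicator (?I n) t \<partial>lborel)"
    by (intro suminf_le) auto
  also have "\<dots> = (\<integral>\<^sup>+t. (\<Sum>n. ennreal (erlang_density m a t) * indicator (?I n) t) \<partial>lborel)"
    by (subst nn_integral_suminf) auto
  also have "\<dots> \<le> (\<integral>\<^sup>+t. ennreal (erlang_density m a t) \<partial>lborel)"
  proof (intro nn_integral_mono)
    fix t :: real
    have "disjoint_family ?I"
      unfolding disjoint_family_on_def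
    proof (intro ballI impI equals0I)
      fix i j :: nat and t
      assume "i \<noteq> j" "t \<in> ?I i \<inter> ?I j"
      then show False by simp
    qed
    then have "(\<Sum>n. ennreal (erlang_density m a t) * indicator (?I n) t) =
        ennreal (erlang_density m a t) * indicator (\<Union>n. ?I n) t"
      by (simp add: suminf_indicator)
    also have "\<dots> \<le> ennreal (erlang_density m a t)" by (auto simp: indicator_def)
    finally show "(\<Sum>n. ennreal (erlang_density m a t) * indicator (?I n) t) \<le>
      ennreal (erlang_density m a t)" .
  qed
  finally have "ennreal (a * exp (- a)) * (\<Sum>n. ennreal (pmf (poisson_pmf (a * real (Suc n))) m)) \<le> 1"
    unfolding total by simp
  then have "ennreal (exp a / a) * (ennreal (a * exp (- a)) *
      (\<Sum>n. ennreal (pmf (poisson_pmf (a * real (Suc n))) m))) \<le> ennreal (exp a / a) * 1"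
    by (rule mult_left_mono) simp
  moreover have "ennreal (exp a / a) * ennreal (a * exp (- a)) = 1"
    using a by (simp add: ennreal_mult[symmetric] exp_minus field_simps)
  ultimately show ?thesis by (simp add: mult.assoc[symmetric])
qed

section \<open>The law of the arrival word\<close>

text \<open>The product over all types \<open>k\<close> of the Poisson masses with parameter
  \<open>r k * h\<close>, taken at 1 for the type in \<open>v\<close> and at 0 for all
  others.\<close>

definition cell_prob :: "('k::finite \<Rightarrow> real) \<Rightarrow> real \<Rightarrow> 'k option \<Rightarrow> real" where
  "cell_prob r h v = (case v of None \<Rightarrow> 1 | Some k \<Rightarrow> r k * h) * exp (- sum r UNIV * h)"

text \<open>Time 0 is set apart so that the Poisson law occurs with positive parameters
  only.\<close>

definition word_pmf :: "('k::finite \<Rightarrow> real) \<Rightarrow> real \<Rightarrow> 'k list pmf" where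
  "word_pmf r t = (if t = 0 then return_pmf []
     else bind_pmf (poisson_pmf (sum r UNIV * t)) (\<lambda>n. replicate_pmf n (letter_pmf r)))"

lemma sum_rates_pos: "(\<And>k::'k::finite. 0 < (r k :: real)) \<Longrightarrow> 0 < sum r UNIV"
  by (intro sum_pos) auto

text \<open>The powers of the total rate cancel between the Poisson weight and the letter weights.
  This leaves the expression in which the counting of cells ends.\<close>

lemma pmf_word_pmf:
  assumes r: "\<And>k. 0 < r k" and t: "0 < t"
  shows "pmf (word_pmf r t) w =
    exp (- sum r UNIV * t) * t ^ length w / fact (length w) * prod_list (map r w)"
proof -
  let ?L = "sum r UNIV"
  have L: "0 < ?L" by (rule sum_rates_pos) (rule r)
  have "prod_list (map (pmf (letter_pmf r)) w) = prod_list (map r w) / ?L ^ length w"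
    by (induction w) (simp_all add: pmf_letter_pmf[OF r])
  moreover have "pmf (word_pmf r t) w =
      pmf (replicate_pmf (length w) (letter_pmf r)) w * pmf (poisson_pmf (?L * t)) (length w)"
    unfolding word_pmf_def using t
    by (simp add: pmf_bind, subst integral_measure_pmf_real[of "{length w}"])
      (auto simp: pmf_replicate_pmf split: if_splits)
  ultimately show ?thesis
    using L t by (simp add: pmf_replicate_pmf power_mult_distrib)
qed

text \<open>Placing \<open>w\<close> into \<open>n\<close> cells means choosing the occupied cells;
  splitting according to the first cell yields Pascal's rule.\<close>

lemma sum_cell_prob:
  "(\<Sum>v | length v = n \<and> letters v = w. prod_list (map (cell_prob r h) v)) =
    real (n choose length w) * h ^ length w * exp (- sum r UNIV * h) ^ n * prod_list (map r w)"
proof (induction n arbitrary: w)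
  case 0
  have "{v :: 'a option list. length v = 0 \<and> letters v = w} = (if w = [] then {[]} else {})" by auto
  then show ?case by (cases w) auto
next
  case (Suc n)
  let ?e = "exp (- sum r UNIV * h)"
  let ?S = "\<lambda>n w. \<Sum>v | length v = n \<and> letters v = w. prod_list (map (cell_prob r h) v)"
  have fin: "finite {v :: 'a option list. length v = n \<and> letters v = w}" for w
    using finite_lists_length_eq[of "UNIV :: 'a option set" n] by (rule rev_finite_subset) auto
  show ?case
  proof (cases w)
    case Nil
    have "{v :: 'a option list. length v = Suc n \<and> letters v = []} =
        Cons None ` {v. length v = n \<and> letters v = []}"
    proof (intro equalityI subsetI)
      fix v :: "'a option list" assume "v \<in> {v. length v = Suc n \<and> letters v = []}"
      then obtain a v' where v: "v = a # v'" "length v' = n" "letters (a # v') = []"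
        by (cases v) auto
      then show "v \<in> Cons None ` {v. length v = n \<and> letters v = []}" by (cases a) auto
    qed auto
    then have "?S (Suc n) [] = ?e * ?S n []"
      by (simp add: sum.reindex cell_prob_def sum_distrib_left)
    then show ?thesis using Suc[of "[]"] Nil by simp
  next
    case (Cons k w')
    have eq: "{v :: 'a option list. length v = Suc n \<and> letters v = w} =
        Cons None ` {v. length v = n \<and> letters v = w} \<union>
        Cons (Some k) ` {v. length v = n \<and> letters v = w'}"
    proof (intro equalityI subsetI)
      fix v :: "'a option list" assume "v \<in> {v. length v = Suc n \<and> letters v = w}"
      then obtain a v' where v: "v = a # v'" "length v' = n" "letters (a # v') = w"
        by (cases v) auto
      then show "v \<in> Cons None ` {v. length v = n \<and> letters v = w} \<union>
        Cons (Some k) ` {v. length v = n \<and> letters v = w'}" using Cons by (cases a) auto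
    qed (use Cons in auto)
    have "?S (Suc n) w = ?e * ?S n w + r k * h * ?e * ?S n w'"
      unfolding eq by (subst sum.union_disjoint)
        (auto simp: fin sum.reindex cell_prob_def sum_distrib_left mult_ac)
    then show ?thesis
      unfolding Suc by (simp add: Cons algebra_simps)
  qed
qed

lemma choose_over_power_tendsto:
  "(\<lambda>n. real (n choose l) / real n ^ l) \<longlonglongrightarrow> 1 / fact l"
proof (induction l)
  case (Suc l)
  have "(\<lambda>n. (real n - real l) / real n) \<longlonglongrightarrow> 1" by real_asymp
  then have "(\<lambda>n. real (n choose l) / real n ^ l * ((real n - real l) / real n) / real (Suc l)) \<longlonglongrightarrow>
      1 / fact l * 1 / real (Suc l)"
    by (intro tendsto_intros Suc) auto
  moreover have "real (n choose l) / real n ^ l * ((real n - real l) / real n) / real (Suc l) =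
      real (n choose Suc l) / real n ^ Suc l" for n
  proof -
    have "(real n - real l) * real (n choose l) = real (Suc l) * real (n choose Suc l)"
      using gbinomial_mult_1[of "real n" l] by (simp add: binomial_gbinomial algebra_simps)
    then show ?thesis by (simp add: divide_simps mult_ac)
  qed
  ultimately show ?case by (simp add: mult_ac)
qed simp

lemma cell_unique:
  assumes "cell T s t v" "cell T s t v'"
  shows "v = v'"
proof -
  have "of_bool (v = Some k) = (of_bool (v' = Some k) :: nat)" for k
    using assms by (simp add: cell_def)
  then have "v = Some k \<longleftrightarrow> v' = Some k" for k by (simp only: of_bool_eq_iff)
  from this[of "the v"] this[of "the v'"] show ?thesis
    by (cases v; cases v') simp_all
qed

context prob_space
begin

lemma sum_mass_le:
  assumes D: "D \<in> events" and X: "X \<in> measurable M (count_space (UNIV :: 'x::countable set))"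
    and le: "\<And>x. c * pmf p x \<le> prob (D \<inter> {\<omega>\<in>space M. X \<omega> = x})" and c: "0 \<le> c"
  shows "c * measure_pmf.prob p T \<le> prob (D \<inter> {\<omega>\<in>space M. X \<omega> \<in> T})"
proof -
  have sets: "{\<omega>\<in>space M. X \<omega> = x} \<in> events" for x
    using X by measurable
  have "ennreal (c * measure_pmf.prob p T) = ennreal c * (\<integral>\<^sup>+x. pmf p x \<partial>count_space T)"
    using c by (simp add: nn_integral_pmf ennreal_mult measure_pmf.emeasure_eq_measure)
  also have "\<dots> = (\<integral>\<^sup>+x. ennreal (c * pmf p x) \<partial>count_space T)"
    using c by (simp add: nn_integral_cmult[symmetric] ennreal_mult)
  also have "\<dots> \<le> (\<integral>\<^sup>+x. emeasure M (D \<inter> {\<omega>\<in>space M. X \<omega> = x}) \<partial>count_space T)"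
    using le by (intro nn_integral_mono) (auto simp: emeasure_eq_measure intro: ennreal_leI)
  also have "\<dots> = emeasure M (\<Union>x\<in>T. D \<inter> {\<omega>\<in>space M. X \<omega> = x})"
    using D sets by (intro emeasure_UN_countable[symmetric]) (auto simp: disjoint_family_on_def)
  also have "(\<Union>x\<in>T. D \<inter> {\<omega>\<in>space M. X \<omega> = x}) = D \<inter> {\<omega>\<in>space M. X \<omega> \<in> T}" by auto
  finally show ?thesis by (simp add: emeasure_eq_measure)
qed

text \<open>The lower bounds for \<open>T\<close> and for \<open>-T\<close> add up to
  \<open>prob D\<close>, which is also the sum of the two actual masses, so neither bound can be
  strict.\<close>

lemma sum_mass_eq:
  assumes D: "D \<in> events" and X: "X \<in> measurable M (count_space (UNIV :: 'x::countable set))"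
    and le: "\<And>x. prob D * pmf p x \<le> prob (D \<inter> {\<omega>\<in>space M. X \<omega> = x})"
  shows "prob (D \<inter> {\<omega>\<in>space M. X \<omega> \<in> T}) = prob D * measure_pmf.prob p T"
proof -
  have sets: "{\<omega>\<in>space M. X \<omega> \<in> T} \<in> events" for T
    using X by measurable
  have le': "prob D * measure_pmf.prob p T \<le> prob (D \<inter> {\<omega>\<in>space M. X \<omega> \<in> T})" for T
    using D X le by (intro sum_mass_le) auto
  have "prob D = prob ((D \<inter> {\<omega>\<in>space M. X \<omega> \<in> T}) \<union> (D \<inter> {\<omega>\<in>space M. X \<omega> \<in> -T}))"
    using sets.sets_into_space[OF D] by (intro arg_cong[where f=prob]) auto
  also have "\<dots> = prob (D \<inter> {\<omega>\<in>space M. X \<omega> \<in> T}) + prob (D \<inter> {\<omega>\<in>space M. X \<omega> \<in> -T})"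
    using D sets by (intro finite_measure_Union) auto
  finally have "prob D = prob (D \<inter> {\<omega>\<in>space M. X \<omega> \<in> T}) + prob (D \<inter> {\<omega>\<in>space M. X \<omega> \<in> -T})" .
  moreover have "prob D = prob D * measure_pmf.prob p T + prob D * measure_pmf.prob p (-T)"
    using measure_pmf.prob_compl[of T p]
    by (simp add: Compl_eq_Diff_UNIV distrib_left[symmetric])
  ultimately show ?thesis using le'[of T] le'[of "-T"] by linarith
qed

end

locale poisson_streams = prob_space M for M :: "'w measure" +
  fixes r :: "'k::finite \<Rightarrow> real" and A :: "'k \<Rightarrow> 'w \<Rightarrow> real set"
  assumes r_pos: "\<And>k. 0 < r k"
    and poisson: "\<And>k. poisson_stream M (r k) (A k)"
    and independent: "independent_streams M A"
begin

abbreviation cells_event :: "(nat \<Rightarrow> real) \<Rightarrow> nat set \<Rightarrow> (nat \<Rightarrow> 'k option) \<Rightarrow> 'w set" where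
  "cells_event \<tau> J v \<equiv> {\<omega>\<in>space M. \<forall>j\<in>J. cell (\<lambda>k. A k \<omega>) (\<tau> j) (\<tau> (Suc j)) (v j)}"

text \<open>Independence of \<open>B\<close> from the arrivals after \<open>s\<close>, tested only
  on outcomes with at most one arrival per cell. This is what the computation of word masses
  consumes, and \<open>past_word\<close> carries it to later times, so it takes the place of a
  filtration. The infinite sequence \<open>\<tau>\<close> follows the format of
  \<open>poisson_stream\<close>.\<close>

definition past :: "real \<Rightarrow> 'w set \<Rightarrow> bool" where
  "past s B \<longleftrightarrow> B \<in> events \<and>
     (\<forall>\<tau> J v. finite J \<and> s \<le> \<tau> 0 \<and> strict_mono \<tau> \<longrightarrow>
        prob (B \<inter> cells_event \<tau> J v) =
        prob B * (\<Prod>j\<in>J. cell_prob r (\<tau> (Suc j) - \<tau> j) (v j)))"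

lemma locally_finite_arrivals: "\<omega> \<in> space M \<Longrightarrow> locally_finite (\<lambda>k. A k \<omega>)"
  using poisson by (auto simp: poisson_stream_def locally_finite_def)

lemma arrivals_eq_diff:
  assumes "\<omega> \<in> space M" "0 \<le> s" "s \<le> t"
  shows "arrivals (A k) s t \<omega> = arrivals (A k) 0 t \<omega> - arrivals (A k) 0 s \<omega>"
proof -
  note lf = locally_finite_arrivals[OF assms(1)]
  have "A k \<omega> \<inter> {s<..t} = A k \<omega> \<inter> {0<..t} - A k \<omega> \<inter> {0<..s}" using assms by auto
  moreover have "A k \<omega> \<inter> {0<..s} \<subseteq> A k \<omega> \<inter> {0<..t}" using assms by auto
  ultimately show ?thesis
    unfolding arrivals_def
    using locally_finite_interval[OF lf, of k 0 s] by (simp only: card_Diff_subset)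
qed

text \<open>The hypothesis speaks of counts from 0; all other counts are differences of these, and
  negative times reduce to 0 because the epochs are positive.\<close>

lemma measurable_arrivals [measurable]:
  "arrivals (A k) s t \<in> measurable M (count_space UNIV)"
proof -
  have base [measurable]: "arrivals (A k) 0 t \<in> measurable M (count_space UNIV)" if "0 \<le> t" for t
    using poisson[of k] that by (simp add: poisson_stream_def)
  have nonneg: "arrivals (A k) s t \<in> measurable M (count_space UNIV)" if "0 \<le> s" "s \<le> t" for s t
  proof (subst measurable_cong)
    show "arrivals (A k) s t \<omega> = arrivals (A k) 0 t \<omega> - arrivals (A k) 0 s \<omega>" if "\<omega> \<in> space M" for \<omega>
      using that \<open>0 \<le> s\<close> \<open>s \<le> t\<close> by (rule arrivals_eq_diff)
    have [measurable]: "arrivals (A k) 0 t \<in> measurable M (count_space UNIV)"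
      "arrivals (A k) 0 s \<in> measurable M (count_space UNIV)" using that by auto
    show "(\<lambda>\<omega>. arrivals (A k) 0 t \<omega> - arrivals (A k) 0 s \<omega>) \<in> measurable M (count_space UNIV)"
      by measurable
  qed
  show ?thesis
  proof (cases "s \<le> t")
    case False
    then show ?thesis by (subst measurable_cong[where g = "\<lambda>_. 0"]) (auto simp: arrivals_def)
  next
    case True
    show ?thesis
    proof (cases "0 \<le> t")
      case True
      have "arrivals (A k) s t \<omega> = arrivals (A k) (max 0 s) t \<omega>" if "\<omega> \<in> space M" for \<omega>
      proof -
        have "A k \<omega> \<subseteq> {0<..}" using poisson[of k] that by (simp add: poisson_stream_def)
        then have "A k \<omega> \<inter> {s<..t} = A k \<omega> \<inter> {max 0 s<..t}" by auto
        then show ?thesis by (simp add: arrivals_def)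
      qed
      then show ?thesis
        using nonneg[of "max 0 s" t] True \<open>s \<le> t\<close> by (subst measurable_cong) auto
    next
      case False
      have "arrivals (A k) s t \<omega> = 0" if "\<omega> \<in> space M" for \<omega>
      proof -
        have "A k \<omega> \<subseteq> {0<..}" using poisson[of k] that by (simp add: poisson_stream_def)
        then have "A k \<omega> \<inter> {s<..t} = {}" using False by auto
        then show ?thesis by (simp add: arrivals_def)
      qed
      then show ?thesis by (subst measurable_cong[where g = "\<lambda>_. 0"]) auto
    qed
  qed
qed

lemma cell_iff_arrivals:
  "cell (\<lambda>k. A k \<omega>) s t v \<longleftrightarrow> (\<forall>k. arrivals (A k) s t \<omega> = of_bool (v = Some k))"
  by (simp add: cell_def arrivals_def)

lemma measurable_cell [measurable]: "Measurable.pred M (\<lambda>\<omega>. cell (\<lambda>k. A k \<omega>) s t v)"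
  unfolding cell_iff_arrivals by measurable

lemma measurable_resolved [measurable]: "Measurable.pred M (\<lambda>\<omega>. resolved (\<lambda>k. A k \<omega>) s t n)"
  unfolding resolved_def by measurable

lemma measurable_cell_word [measurable]:
  "(\<lambda>\<omega>. cell_word (\<lambda>k. A k \<omega>) s t) \<in> measurable M (count_space UNIV)"
proof -
  have "(\<lambda>\<omega>. {k. card (A k \<omega> \<inter> {s<..t}) \<noteq> 0}) \<in> measurable M (count_space UNIV)"
  proof (subst measurable_count_space_eq2_countable)
    have "(\<lambda>\<omega>. {k. card (A k \<omega> \<inter> {s<..t}) \<noteq> 0}) -` {K} \<inter> space M \<in> events" for K
    proof -
      have "(\<lambda>\<omega>. {k. card (A k \<omega> \<inter> {s<..t}) \<noteq> 0}) -` {K} \<inter> space M =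
          {\<omega>\<in>space M. \<forall>k. arrivals (A k) s t \<omega> \<noteq> 0 \<longleftrightarrow> k \<in> K}"
        by (auto simp: arrivals_def)
      also have "\<dots> \<in> events" by measurable
      finally show ?thesis .
    qed
    then show "(\<lambda>\<omega>. {k. card (A k \<omega> \<inter> {s<..t}) \<noteq> 0}) \<in> space M \<rightarrow> UNIV \<and>
      (\<forall>K\<in>UNIV. (\<lambda>\<omega>. {k. card (A k \<omega> \<inter> {s<..t}) \<noteq> 0}) -` {K} \<inter> space M \<in> events)" by auto
  qed
  then show ?thesis
    unfolding cell_word_def
    by (rule measurable_compose) simp
qed

lemma measurable_approx_word [measurable]:
  "(\<lambda>\<omega>. approx_word (\<lambda>k. A k \<omega>) s t n) \<in> measurable M (count_space UNIV)"
proof -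
  have "(\<lambda>\<omega>. concat (map (\<lambda>j. cell_word (\<lambda>k. A k \<omega>) (\<tau> j) (\<tau> (Suc j))) [0..<n]))
      \<in> measurable M (count_space UNIV)" for \<tau>
  proof (induction n)
    case (Suc n)
    have "(\<lambda>\<omega>. (\<lambda>w. concat (map (\<lambda>j. cell_word (\<lambda>k. A k \<omega>) (\<tau> j) (\<tau> (Suc j))) [0..<n]) @ w)
       (cell_word (\<lambda>k. A k \<omega>) (\<tau> n) (\<tau> (Suc n)))) \<in> measurable M (count_space UNIV)"
      by (rule measurable_compose_countable)
        (auto intro: measurable_compose[OF Suc])
    then show ?case by simp
  qed simp
  then show ?thesis unfolding approx_word_def .
qed

lemma measurable_word:
  assumes "s \<le> t"
  shows "(\<lambda>\<omega>. word (\<lambda>k. A k \<omega>) s t) \<in> measurable M (count_space UNIV)"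
proof (subst measurable_count_space_eq2_countable)
  have "(\<lambda>\<omega>. word (\<lambda>k. A k \<omega>) s t) -` {w} \<inter> space M \<in> events" for w
  proof -
    have "(\<lambda>\<omega>. word (\<lambda>k. A k \<omega>) s t) -` {w} \<inter> space M =
        {\<omega>\<in>space M. \<exists>N. \<forall>n\<ge>N. approx_word (\<lambda>k. A k \<omega>) s t n = w}"
      using word_eq_iff[OF locally_finite_arrivals assms] by auto
    also have "\<dots> \<in> events" by measurable
    finally show ?thesis .
  qed
  then show "(\<lambda>\<omega>. word (\<lambda>k. A k \<omega>) s t) \<in> space M \<rightarrow> UNIV \<and>
    (\<forall>w\<in>UNIV. (\<lambda>\<omega>. word (\<lambda>k. A k \<omega>) s t) -` {w} \<inter> space M \<in> events)" by auto
qed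

lemma past_eventsD: "past s B \<Longrightarrow> B \<in> events"
  by (simp add: past_def)

lemma past_cells:
  "past s B \<Longrightarrow> finite J \<Longrightarrow> s \<le> \<tau> 0 \<Longrightarrow> strict_mono \<tau> \<Longrightarrow>
    prob (B \<inter> cells_event \<tau> J v) =
        prob B * (\<Prod>j\<in>J. cell_prob r (\<tau> (Suc j) - \<tau> j) (v j))"
  unfolding past_def by blast

text \<open>Used to sum over the possible initial states, since \<open>past_queue\<close> works with
  events that fix the current state.\<close>

lemma past_union:
  assumes B: "\<And>x. past s (B x)" and disj: "disjoint_family B"
  shows "past s (\<Union>x::'x::countable. B x)"
  unfolding past_def
proof (intro conjI allI impI)
  have ev: "B x \<in> events" for x using B past_eventsD by blast
  show "(\<Union>x. B x) \<in> events" using ev by (intro sets.countable_UN') auto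
  fix \<tau> :: "nat \<Rightarrow> real" and J :: "nat set" and v :: "nat \<Rightarrow> 'k option"
  assume asm: "finite J \<and> s \<le> \<tau> 0 \<and> strict_mono \<tau>"
  let ?c = "\<Prod>j\<in>J. cell_prob r (\<tau> (Suc j) - \<tau> j) (v j)"
  have C [measurable]: "cells_event \<tau> J v \<in> events" using asm by measurable
  have c: "0 \<le> ?c"
    using asm r_pos by (intro prod_nonneg)
      (auto simp: cell_prob_def strict_mono_less_eq less_imp_le split: option.split)
  have "emeasure M ((\<Union>x. B x) \<inter> cells_event \<tau> J v) = emeasure M (\<Union>x. B x \<inter> cells_event \<tau> J v)"
    by (intro arg_cong[where f="emeasure M"]) auto
  also have "\<dots> = (\<integral>\<^sup>+x. emeasure M (B x \<inter> cells_event \<tau> J v) \<partial>count_space UNIV)"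
    using ev C disj by (intro emeasure_UN_countable) (auto simp: disjoint_family_on_def)
  also have "\<dots> = (\<integral>\<^sup>+x. ennreal ?c * emeasure M (B x) \<partial>count_space UNIV)"
    using past_cells[OF B, where J = J and \<tau> = \<tau> and v = v] asm c
    by (intro nn_integral_cong) (simp add: emeasure_eq_measure ennreal_mult mult.commute)
  also have "\<dots> = ennreal ?c * emeasure M (\<Union>x. B x)"
    using ev disj by (subst emeasure_UN_countable) (auto simp: nn_integral_cmult)
  also have "\<dots> = ennreal (?c * prob (\<Union>x. B x))"
    using c by (simp add: emeasure_eq_measure ennreal_mult)
  finally show "prob ((\<Union>x. B x) \<inter> cells_event \<tau> J v) = prob (\<Union>x. B x) * ?c"
    using c by (simp add: emeasure_eq_measure mult.commute)
qed

text \<open>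
  Cutting \<open>{s<..u}\<close> into \<open>n\<close> equal cells and counting only the outcomes with at most one arrival
  per cell yields the fraction \<open>fact l * (n choose l) / n ^ l\<close> of the expected mass of a word of
  length \<open>l\<close>.  In the limit, the lower bounds for all words add up to the whole mass and hence are
  attained.
\<close>

lemma word_mass_le:
  assumes B: "past s B" and su: "0 \<le> s" "s < u" and J: "finite J"
    and \<tau>: "u \<le> \<tau> 0" "strict_mono \<tau>"
  shows "prob (B \<inter> cells_event \<tau> J x) * pmf (word_pmf r (u - s)) w \<le>
    prob ((B \<inter> cells_event \<tau> J x) \<inter>
      {\<omega>\<in>space M. word (\<lambda>k. A k \<omega>) s u = w \<and> (\<exists>n. resolved (\<lambda>k. A k \<omega>) s u n)})"
    (is "prob ?D * _ \<le> prob ?G")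
proof -
  have [measurable]: "B \<in> events" using B by (rule past_eventsD)
  have [measurable]: "(\<lambda>\<omega>. word (\<lambda>k. A k \<omega>) s u) \<in> measurable M (count_space UNIV)"
    using su by (intro measurable_word) auto
  have G: "?G \<in> events" using J by measurable
  let ?c = "\<Prod>j\<in>J. cell_prob r (\<tau> (Suc j) - \<tau> j) (x j)"
  have D: "prob ?D = prob B * ?c"
    using su J \<tau> by (intro past_cells[OF B]) auto
  have bound: "prob ?D * (real (n choose length w) * ((u - s) / n) ^ length w *
      exp (- sum r UNIV * ((u - s) / n)) ^ n * prod_list (map r w)) \<le> prob ?G"
    if n: "0 < n" for n
  proof -
    \<comment> \<open>\<open>\<sigma>\<close> is the grid of \<open>{s<..u}\<close> continued by
      \<open>\<tau>\<close>, which starts at index \<open>e\<close>. If \<open>\<tau> 0 = u\<close>,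
      the end of the grid and the start of \<open>\<tau>\<close> share the index \<open>n\<close>;
      otherwise cell \<open>n\<close> is the gap between them, and \<open>J'\<close> leaves it
      unconstrained.\<close>
    define e where "e = (if \<tau> 0 = u then n else Suc n)"
    define \<sigma> where "\<sigma> j = (if j \<le> n then grid s u n j else \<tau> (j - e))" for j
    define J' where "J' = {..<n} \<union> (\<lambda>j. j + e) ` J"
    have \<sigma>e: "\<sigma> (j + e) = \<tau> j" for j
      using n by (auto simp: \<sigma>_def e_def)
    have mono: "strict_mono \<sigma>"
      unfolding strict_mono_Suc_iff
    proof
      fix j
      consider "j < n" | "j = n" | "n < j" by linarith
      then show "\<sigma> j < \<sigma> (Suc j)"
      proof cases
        case 1
        then show ?thesis using su n by (simp add: \<sigma>_def grid_strict_mono)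
      next
        case 2
        have "u < \<tau> (Suc 0)" using \<tau> strict_monoD[OF \<tau>(2), of 0 "Suc 0"] by simp
        then show ?thesis using 2 n \<tau> by (auto simp: \<sigma>_def e_def)
      next
        case 3
        then have "Suc j - e = Suc (j - e)" by (auto simp: e_def)
        then show ?thesis using 3 \<tau> by (simp add: \<sigma>_def strict_mono_Suc_iff)
      qed
    qed
    define y where "y v j = (if j < n then v ! j else x (j - e))" for v :: "'k option list" and j
    have n_e: "n \<le> e" by (simp add: e_def)
    define F where "F v = B \<inter> cells_event \<sigma> J' (y v)" for v
    have F_eq: "F v = ?D \<inter> {\<omega>\<in>space M. \<forall>j<n. cell (\<lambda>k. A k \<omega>) (grid s u n j) (grid s u n (Suc j)) (v ! j)}" for v
    proof -
      have "\<sigma> (Suc (j + e)) = \<tau> (Suc j)" for j using \<sigma>e[of "Suc j"] by simp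
      moreover have "y v (j + e) = x j" for j using n_e by (simp add: y_def)
      moreover have "\<sigma> j = grid s u n j" "\<sigma> (Suc j) = grid s u n (Suc j)" "y v j = v ! j" if "j < n" for j
        using that by (auto simp: \<sigma>_def y_def)
      ultimately show ?thesis
        unfolding F_def J'_def by (auto simp: ball_Un \<sigma>e)
    qed
    have F_ev: "F v \<in> events" for v
      unfolding F_eq using J by measurable
    define V where "V = {v :: 'k option list. length v = n \<and> letters v = w}"
    have V: "finite V" unfolding V_def
      using finite_lists_length_eq[of "UNIV :: 'k option set" n] by (rule rev_finite_subset) auto
    have PF: "prob (F v) = prob ?D * prod_list (map (cell_prob r ((u - s) / n)) v)" if "v \<in> V" for v
    proof -
      have "prob (F v) = prob B * (\<Prod>j\<in>J'. cell_prob r (\<sigma> (Suc j) - \<sigma> j) (y v j))"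
        unfolding F_def
      proof (rule past_cells[OF B _ _ mono])
        show "finite J'" using J by (simp add: J'_def)
        show "s \<le> \<sigma> 0" by (simp add: \<sigma>_def)
      qed
      also have "(\<Prod>j\<in>J'. cell_prob r (\<sigma> (Suc j) - \<sigma> j) (y v j)) =
          (\<Prod>j<n. cell_prob r (\<sigma> (Suc j) - \<sigma> j) (y v j)) *
          (\<Prod>j\<in>(\<lambda>j. j + e) ` J. cell_prob r (\<sigma> (Suc j) - \<sigma> j) (y v j))"
        unfolding J'_def using J n_e by (intro prod.union_disjoint) auto
      also have "(\<Prod>j<n. cell_prob r (\<sigma> (Suc j) - \<sigma> j) (y v j)) =
          (\<Prod>j<n. cell_prob r ((u - s) / n) (v ! j))"
        by (intro prod.cong) (auto simp: \<sigma>_def y_def grid_Suc)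
      also have "\<dots> = prod_list (map (cell_prob r ((u - s) / n)) v)"
        using that by (simp add: V_def prod.list_conv_set_nth atLeast0LessThan)
      also have "(\<Prod>j\<in>(\<lambda>j. j + e) ` J. cell_prob r (\<sigma> (Suc j) - \<sigma> j) (y v j)) = ?c"
        using n_e \<sigma>e[of "Suc _"] by (subst prod.reindex) (auto simp: \<sigma>e y_def intro!: prod.cong)
      finally show ?thesis unfolding D by simp
    qed
    have "disjoint_family_on F V"
      unfolding disjoint_family_on_def
    proof safe
      fix v v' \<omega> assume v: "v \<in> V" "v' \<in> V" "v \<noteq> v'" and \<omega>: "\<omega> \<in> F v" "\<omega> \<in> F v'"
      have "v ! j = v' ! j" if "j < n" for j
        using \<omega> that unfolding F_eq by (auto intro: cell_unique)
      then have "v = v'" using v unfolding V_def by (auto intro: nth_equalityI)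
      then show "\<omega> \<in> {}" using v by simp
    qed
    then have "(\<Sum>v\<in>V. prob (F v)) = prob (\<Union>v\<in>V. F v)"
      using F_ev V by (intro finite_measure_finite_Union[symmetric]) auto
    also have "\<dots> \<le> prob ?G"
    proof (intro finite_measure_mono G UN_least subsetI)
      fix v \<omega> assume v: "v \<in> V" and \<omega>: "\<omega> \<in> F v"
      have cells: "\<And>j. j < n \<Longrightarrow> cell (\<lambda>k. A k \<omega>) (grid s u n j) (grid s u n (Suc j)) (v ! j)"
        and in_D: "\<omega> \<in> ?D"
        using \<omega> unfolding F_eq by auto
      have "word (\<lambda>k. A k \<omega>) s u = letters v"
        using v n su cells in_D unfolding V_def
        by (intro cells_imp_word locally_finite_arrivals) auto
      moreover have "resolved (\<lambda>k. A k \<omega>) s u n"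
        unfolding resolved_def using n cells by blast
      ultimately show "\<omega> \<in> ?G" using in_D v unfolding V_def by auto
    qed
    finally have "prob ?D * (\<Sum>v\<in>V. prod_list (map (cell_prob r ((u - s) / n)) v)) \<le> prob ?G"
      using PF by (simp add: sum_distrib_left)
    then show ?thesis unfolding V_def sum_cell_prob .
  qed
  let ?l = "length w"
  let ?K = "prob ?D * (u - s) ^ ?l * exp (- sum r UNIV * (u - s)) * prod_list (map r w)"
  have "(\<lambda>n. ?K * (real (n choose ?l) / real n ^ ?l)) \<longlonglongrightarrow> ?K * (1 / fact ?l)"
    by (intro tendsto_intros choose_over_power_tendsto)
  moreover have "?K * (1 / fact ?l) = prob ?D * pmf (word_pmf r (u - s)) w"
    using su by (subst pmf_word_pmf[OF r_pos]) auto
  moreover have "\<forall>\<^sub>F n in sequentially. ?K * (real (n choose ?l) / real n ^ ?l) \<le> prob ?G"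
    using eventually_gt_at_top[of 0]
  proof eventually_elim
    case (elim n)
    have "exp (- sum r UNIV * ((u - s) / n)) ^ n = exp (- sum r UNIV * (u - s))"
      using elim by (simp flip: exp_of_nat_mult)
    then show ?case using bound[OF elim] by (simp add: power_divide mult_ac)
  qed
  ultimately show ?thesis
    using tendsto_upperbound[OF _ _ sequentially_bot,
      of "\<lambda>n. ?K * (real (n choose ?l) / real n ^ ?l)" "?K * (1 / fact ?l)" "prob ?G"] by simp
qed

lemma word_mass_eq:
  assumes "past s B" "0 \<le> s" "s < u" "finite J" "u \<le> \<tau> 0" "strict_mono \<tau>"
  shows "prob ((B \<inter> cells_event \<tau> J x) \<inter> {\<omega>\<in>space M. word (\<lambda>k. A k \<omega>) s u \<in> T}) =
    prob (B \<inter> cells_event \<tau> J x) * measure_pmf.prob (word_pmf r (u - s)) T"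
proof (rule sum_mass_eq)
  have [measurable]: "B \<in> events" using assms(1) by (rule past_eventsD)
  show m [measurable]: "(\<lambda>\<omega>. word (\<lambda>k. A k \<omega>) s u) \<in> measurable M (count_space UNIV)"
    using assms by (intro measurable_word) auto
  show D [measurable]: "B \<inter> cells_event \<tau> J x \<in> events" using assms(4) by measurable
  show "prob (B \<inter> cells_event \<tau> J x) * pmf (word_pmf r (u - s)) w \<le>
    prob ((B \<inter> cells_event \<tau> J x) \<inter> {\<omega>\<in>space M. word (\<lambda>k. A k \<omega>) s u = w})" for w
    by (rule order_trans[OF word_mass_le[OF assms]], rule finite_measure_mono) (auto, measurable)
qed

text \<open>\<open>word_mass_eq\<close> holds jointly with the cells after \<open>u\<close>. Without
  such cells it gives the law of the word; with them it shows that conditioning on the word keeps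
  the future independent, so that words over successive intervals can be chained.\<close>

lemma past_word:
  assumes B: "past s B" and su: "0 \<le> s" "s \<le> u"
  shows "prob (B \<inter> {\<omega>\<in>space M. word (\<lambda>k. A k \<omega>) s u \<in> T}) =
      prob B * measure_pmf.prob (word_pmf r (u - s)) T" (is ?P)
    and "past u (B \<inter> {\<omega>\<in>space M. word (\<lambda>k. A k \<omega>) s u \<in> T})" (is ?Q)
proof -
  have [measurable]: "B \<in> events" using B by (rule past_eventsD)
  have [measurable]: "(\<lambda>\<omega>. word (\<lambda>k. A k \<omega>) s u) \<in> measurable M (count_space UNIV)"
    using su by (intro measurable_word) auto
  have "?P \<and> ?Q"
  proof (cases "s = u")
    case True
    have "B \<inter> {\<omega>\<in>space M. [] \<in> T} = (if [] \<in> T then B else {})"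
      using sets.sets_into_space[OF past_eventsD[OF B]] by auto
    then show ?thesis using True B by (auto simp: word_pmf_def past_def)
  next
    case False
    then have su': "s < u" using su by simp
    have P: ?P
    proof -
      \<comment> \<open>With \<open>J = {}\<close> the sequence is a dummy; any increasing one that
        starts at \<open>u\<close> will do.\<close>
      have "strict_mono (\<lambda>j. u + real j)" by (simp add: strict_mono_def)
      from word_mass_eq[OF B su(1) su' _ _ this, of "{}"]
      have "prob (B \<inter> space M \<inter> {\<omega>\<in>space M. word (\<lambda>k. A k \<omega>) s u \<in> T}) =
        prob (B \<inter> space M) * measure_pmf.prob (word_pmf r (u - s)) T" by simp
      then show ?thesis using sets.sets_into_space[OF past_eventsD[OF B]] by (simp add: Int_absorb2)
    qed
    moreover have ?Q
      unfolding past_def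
    proof (intro conjI allI impI)
      show "B \<inter> {\<omega>\<in>space M. word (\<lambda>k. A k \<omega>) s u \<in> T} \<in> events" by measurable
      fix \<tau> :: "nat \<Rightarrow> real" and J :: "nat set" and x :: "nat \<Rightarrow> 'k option"
      assume asm: "finite J \<and> u \<le> \<tau> 0 \<and> strict_mono \<tau>"
      let ?c = "\<Prod>j\<in>J. cell_prob r (\<tau> (Suc j) - \<tau> j) (x j)"
      have "prob (B \<inter> {\<omega>\<in>space M. word (\<lambda>k. A k \<omega>) s u \<in> T} \<inter> cells_event \<tau> J x) =
        prob ((B \<inter> cells_event \<tau> J x) \<inter> {\<omega>\<in>space M. word (\<lambda>k. A k \<omega>) s u \<in> T})"
        by (intro arg_cong[where f=prob]) auto
      also have "\<dots> = prob (B \<inter> cells_event \<tau> J x) * measure_pmf.prob (word_pmf r (u - s)) T"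
        using asm by (intro word_mass_eq B su su') auto
      also have "prob (B \<inter> cells_event \<tau> J x) = prob B * ?c"
        using asm su by (intro past_cells[OF B]) auto
      finally show "prob (B \<inter> {\<omega>\<in>space M. word (\<lambda>k. A k \<omega>) s u \<in> T} \<inter> cells_event \<tau> J x) =
        prob (B \<inter> {\<omega>\<in>space M. word (\<lambda>k. A k \<omega>) s u \<in> T}) * ?c"
        unfolding P by simp
    qed
    ultimately show ?thesis by blast
  qed
  then show ?P ?Q by auto
qed

text \<open>Independence of the streams is stated for whole counting paths, so cell outcomes have to
  be preimages of measurable sets of paths. The truncated subtraction is exact on counting paths,
  which are monotone.\<close>

definition path_cell :: "(nat \<Rightarrow> real) \<Rightarrow> nat set \<Rightarrow> (nat \<Rightarrow> nat) \<Rightarrow> (real \<Rightarrow> nat) set" where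
  "path_cell \<tau> J n = {g\<in>space path_space. \<forall>j\<in>J. g (\<tau> (Suc j)) - g (\<tau> j) = n j}"

lemma path_cell:
  assumes J: "finite J" and \<tau>: "0 \<le> \<tau> 0" "strict_mono \<tau>"
  shows "path_cell \<tau> J n \<in> sets path_space"
    and "counting_path (A k) -` path_cell \<tau> J n \<inter> space M =
      {\<omega>\<in>space M. \<forall>j\<in>J. arrivals (A k) (\<tau> j) (\<tau> (Suc j)) \<omega> = n j}"
    and "cells_event \<tau> J v =
      (\<Inter>k. counting_path (A k) -` path_cell \<tau> J (\<lambda>j. of_bool (v j = Some k)) \<inter> space M)"
proof -
  have nonneg: "0 \<le> \<tau> j" for j
    using \<tau> strict_mono_less_eq[OF \<tau>(2), of 0 j] by simp
  have le: "\<tau> j \<le> \<tau> (Suc j)" for j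
    using strict_mono_less_eq[OF \<tau>(2), of j "Suc j"] by simp
  have [measurable]: "(\<lambda>g. g (\<tau> j)) \<in> measurable path_space (count_space UNIV)" for j
    using nonneg by (intro measurable_component_singleton) auto
  show "path_cell \<tau> J n \<in> sets path_space" unfolding path_cell_def using J by measurable
  have path: "counting_path (A k) \<omega> \<in> space path_space" for k \<omega>
    by (auto simp: counting_path_def space_PiM)
  have diff: "counting_path (A k) \<omega> (\<tau> (Suc j)) - counting_path (A k) \<omega> (\<tau> j) =
      arrivals (A k) (\<tau> j) (\<tau> (Suc j)) \<omega>" if "\<omega> \<in> space M" for k \<omega> j
    using arrivals_eq_diff[OF that nonneg le, of k j] nonneg by (simp add: counting_path_def)
  show eq: "counting_path (A k) -` path_cell \<tau> J n \<inter> space M =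
      {\<omega>\<in>space M. \<forall>j\<in>J. arrivals (A k) (\<tau> j) (\<tau> (Suc j)) \<omega> = n j}" for k n
    using path diff by (auto simp: path_cell_def)
  show "cells_event \<tau> J v =
      (\<Inter>k. counting_path (A k) -` path_cell \<tau> J (\<lambda>j. of_bool (v j = Some k)) \<inter> space M)"
    unfolding eq cell_iff_arrivals by auto
qed

lemma prob_arrivals:
  assumes "0 \<le> s" "s < t"
  shows "prob {\<omega>\<in>space M. arrivals (A k) s t \<omega> = n} = pmf (poisson_pmf (r k * (t - s))) n"
proof -
  have "distr M (count_space UNIV) (arrivals (A k) s t) = measure_pmf (poisson_pmf (r k * (t - s)))"
    using poisson[of k] assms by (simp add: poisson_stream_def)
  then have "measure (distr M (count_space UNIV) (arrivals (A k) s t)) {n} = pmf (poisson_pmf (r k * (t - s))) n"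
    by (simp add: pmf.rep_eq)
  then show ?thesis by (simp add: measure_distr vimage_def Int_def conj_commute)
qed

text \<open>Disjoint intervals of one stream are independent (\<open>P1\<close>), and so are
  different streams. Swapping the two products collects the factors by cell: at most one type
  contributes \<open>r k * h\<close>, and the exponentials combine to the total rate.\<close>

lemma prob_cells_event:
  assumes J: "finite J" and \<tau>: "0 \<le> \<tau> 0" "strict_mono \<tau>"
  shows "prob (cells_event \<tau> J v) = (\<Prod>j\<in>J. cell_prob r (\<tau> (Suc j) - \<tau> j) (v j))"
proof -
  note Z = path_cell[OF J \<tau>]
  have nonneg: "0 \<le> \<tau> j" for j
    using \<tau> strict_mono_less_eq[OF \<tau>(2), of 0 j] by simp
  have less: "\<tau> j < \<tau> (Suc j)" for j
    using strict_mono_less[OF \<tau>(2), of j "Suc j"] by simp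
  have P1: "prob {\<omega>\<in>space M. \<forall>j\<in>J. arrivals (A k) (\<tau> j) (\<tau> (Suc j)) \<omega> = n j} =
     (\<Prod>j\<in>J. pmf (poisson_pmf (r k * (\<tau> (Suc j) - \<tau> j))) (n j))" for k n
  proof (cases "J = {}")
    case False
    have ind: "indep_vars (\<lambda>_. count_space UNIV) (\<lambda>j. arrivals (A k) (\<tau> j) (\<tau> (Suc j))) UNIV"
      using poisson[of k] \<tau> by (simp add: poisson_stream_def)
    have "prob (\<Inter>j\<in>J. arrivals (A k) (\<tau> j) (\<tau> (Suc j)) -` {n j} \<inter> space M) =
      (\<Prod>j\<in>J. prob (arrivals (A k) (\<tau> j) (\<tau> (Suc j)) -` {n j} \<inter> space M))"
      using J False by (intro indep_varsD[OF ind]) auto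
    moreover have "(\<Inter>j\<in>J. arrivals (A k) (\<tau> j) (\<tau> (Suc j)) -` {n j} \<inter> space M) =
        {\<omega>\<in>space M. \<forall>j\<in>J. arrivals (A k) (\<tau> j) (\<tau> (Suc j)) \<omega> = n j}"
      using False by auto
    moreover have "arrivals (A k) (\<tau> j) (\<tau> (Suc j)) -` {n j} \<inter> space M =
        {\<omega>\<in>space M. arrivals (A k) (\<tau> j) (\<tau> (Suc j)) \<omega> = n j}" for j
      by auto
    ultimately show ?thesis using prob_arrivals[OF nonneg less] by simp
  qed (simp add: prob_space)
  have "prob (cells_event \<tau> J v) =
      (\<Prod>k\<in>UNIV. \<Prod>j\<in>J. pmf (poisson_pmf (r k * (\<tau> (Suc j) - \<tau> j))) (of_bool (v j = Some k)))"
    unfolding Z(3)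
    by (subst indep_varsD_finite[OF independent[unfolded independent_streams_def]])
      (simp_all only: Z(1) Z(2) P1 finite UNIV_not_empty not_False_eq_True)
  also have "\<dots> = (\<Prod>j\<in>J. \<Prod>k\<in>UNIV. pmf (poisson_pmf (r k * (\<tau> (Suc j) - \<tau> j))) (of_bool (v j = Some k)))"
    by (rule prod.swap)
  also have "\<dots> = (\<Prod>j\<in>J. cell_prob r (\<tau> (Suc j) - \<tau> j) (v j))"
  proof (intro prod.cong refl)
    fix j
    define h where "h = \<tau> (Suc j) - \<tau> j"
    have h: "0 < h" using less[of j] by (simp add: h_def)
    have "(\<Prod>k\<in>UNIV. pmf (poisson_pmf (r k * h)) (of_bool (v j = Some k))) =
        (\<Prod>k\<in>UNIV. (if v j = Some k then r k * h else 1) * exp (- (r k * h)))"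
      using h r_pos by (intro prod.cong) auto
    also have "\<dots> = (\<Prod>k\<in>UNIV. if v j = Some k then r k * h else 1) * exp (- sum r UNIV * h)"
      by (simp add: prod.distrib exp_sum[symmetric] sum_negf sum_distrib_right)
    also have "(\<Prod>k\<in>UNIV. if v j = Some k then r k * h else 1) =
        (case v j of None \<Rightarrow> 1 | Some k \<Rightarrow> r k * h)"
      by (cases "v j") (auto simp: prod.delta')
    also have "\<dots> * exp (- sum r UNIV * h) = cell_prob r h (v j)" by (simp add: cell_prob_def)
    finally show "(\<Prod>k\<in>UNIV. pmf (poisson_pmf (r k * (\<tau> (Suc j) - \<tau> j))) (of_bool (v j = Some k))) =
        cell_prob r (\<tau> (Suc j) - \<tau> j) (v j)" unfolding h_def .
  qed
  finally show ?thesis .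
qed

lemma past_space: "past 0 (space M)"
  unfolding past_def
proof (intro conjI allI impI)
  fix \<tau> :: "nat \<Rightarrow> real" and J :: "nat set" and v :: "nat \<Rightarrow> 'k option"
  assume "finite J \<and> 0 \<le> \<tau> 0 \<and> strict_mono \<tau>"
  then have "prob (cells_event \<tau> J v) = (\<Prod>j\<in>J. cell_prob r (\<tau> (Suc j) - \<tau> j) (v j))"
    by (intro prob_cells_event) auto
  moreover have "space M \<inter> cells_event \<tau> J v = cells_event \<tau> J v" by auto
  ultimately show "prob (space M \<inter> cells_event \<tau> J v) =
    prob (space M) * (\<Prod>j\<in>J. cell_prob r (\<tau> (Suc j) - \<tau> j) (v j))"
    by (simp add: prob_space)
qed simp

text \<open>A cell outcome is the preimage of a box in the product of the path spaces, so it belongs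
  to the sigma-algebra of which \<open>X0\<close> is independent.\<close>

lemma past_initial_state:
  assumes "independent_initial_state M A X0"
  shows "past 0 {\<omega>\<in>space M. X0 \<omega> = q}"
  unfolding past_def
proof (intro conjI allI impI)
  note indep = assms[unfolded independent_initial_state_def]
  let ?X = "vimage_algebra (space M) X0 (count_space UNIV)"
  let ?Y = "vimage_algebra (space M) (\<lambda>\<omega> k. counting_path (A k) \<omega>) (PiM UNIV (\<lambda>_. path_space))"
  have "X0 -` {q} \<inter> space M \<in> sets ?X" by (rule in_vimage_algebra) simp
  also have "X0 -` {q} \<inter> space M = {\<omega>\<in>space M. X0 \<omega> = q}" by auto
  finally have X: "{\<omega>\<in>space M. X0 \<omega> = q} \<in> sets ?X" .
  then show "{\<omega>\<in>space M. X0 \<omega> = q} \<in> events"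
    using indep_setD_ev1[OF indep] by blast
  fix \<tau> :: "nat \<Rightarrow> real" and J :: "nat set" and v :: "nat \<Rightarrow> 'k option"
  assume "finite J \<and> 0 \<le> \<tau> 0 \<and> strict_mono \<tau>"
  then have J: "finite J" and \<tau>: "0 \<le> \<tau> 0" "strict_mono \<tau>" by auto
  note Z = path_cell[OF J \<tau>]
  let ?Z = "\<lambda>k. path_cell \<tau> J (\<lambda>j. of_bool (v j = Some k))"
  have "cells_event \<tau> J v =
      (\<lambda>\<omega> k. counting_path (A k) \<omega>) -` (PiE UNIV ?Z) \<inter> space M"
    unfolding Z(3) by auto
  also have "\<dots> \<in> sets ?Y"
    using Z(1) by (intro in_vimage_algebra sets_PiM_I_finite) auto
  finally have "prob ({\<omega>\<in>space M. X0 \<omega> = q} \<inter> cells_event \<tau> J v) =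
      prob {\<omega>\<in>space M. X0 \<omega> = q} * prob (cells_event \<tau> J v)"
    by (intro indep_setD[OF indep X])
  then show "prob ({\<omega>\<in>space M. X0 \<omega> = q} \<inter> cells_event \<tau> J v) =
    prob {\<omega>\<in>space M. X0 \<omega> = q} * (\<Prod>j\<in>J. cell_prob r (\<tau> (Suc j) - \<tau> j) (v j))"
    using prob_cells_event[OF J \<tau>] by simp
qed

lemma prob_word:
  assumes "0 \<le> t"
  shows "prob {\<omega>\<in>space M. word (\<lambda>k. A k \<omega>) 0 t \<in> T} = measure_pmf.prob (word_pmf r t) T"
proof -
  have "space M \<inter> {\<omega>\<in>space M. word (\<lambda>k. A k \<omega>) 0 t \<in> T} = {\<omega>\<in>space M. word (\<lambda>k. A k \<omega>) 0 t \<in> T}"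
    by auto
  then show ?thesis using past_word(1)[OF past_space, of t T] assms by (simp add: prob_space)
qed

text \<open>The lower bounds of \<open>word_mass_le\<close> count resolved outcomes only, and summed
  over all words they already give 1.\<close>

lemma AE_resolved:
  assumes t: "0 < t"
  shows "AE \<omega> in M. \<exists>n. resolved (\<lambda>k. A k \<omega>) 0 t n"
proof -
  have [measurable]: "(\<lambda>\<omega>. word (\<lambda>k. A k \<omega>) 0 t) \<in> measurable M (count_space UNIV)"
    using t by (intro measurable_word) auto
  let ?S = "{\<omega>\<in>space M. \<exists>n. resolved (\<lambda>k. A k \<omega>) 0 t n}"
  have "1 * measure_pmf.prob (word_pmf r t) UNIV \<le> prob (?S \<inter> {\<omega>\<in>space M. word (\<lambda>k. A k \<omega>) 0 t \<in> UNIV})"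
  proof (rule sum_mass_le)
    fix w
    have "strict_mono (\<lambda>j. t + real j)" by (simp add: strict_mono_def)
    from word_mass_le[OF past_space _ t _ _ this, of "{}" undefined w]
    have "pmf (word_pmf r t) w \<le> prob (space M \<inter>
      {\<omega>\<in>space M. word (\<lambda>k. A k \<omega>) 0 t = w \<and> (\<exists>n. resolved (\<lambda>k. A k \<omega>) 0 t n)})"
      by (simp add: prob_space)
    also have "space M \<inter> {\<omega>\<in>space M. word (\<lambda>k. A k \<omega>) 0 t = w \<and> (\<exists>n. resolved (\<lambda>k. A k \<omega>) 0 t n)} =
       ?S \<inter> {\<omega>\<in>space M. word (\<lambda>k. A k \<omega>) 0 t = w}" by auto
    finally show "1 * pmf (word_pmf r t) w \<le> prob (?S \<inter> {\<omega>\<in>space M. word (\<lambda>k. A k \<omega>) 0 t = w})" by simp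
  qed auto
  then have "1 \<le> prob (?S \<inter> space M)" by simp
  also have "?S \<inter> space M = ?S" by auto
  finally have "prob ?S = 1" by (intro antisym prob_le_1)
  then show ?thesis by (subst (asm) prob_Collect_eq_1) auto
qed

end

section \<open>The discrete queue\<close>

locale matching_rates =
  fixes E :: "('s::finite \<times> 'c::finite) set" and lam :: "'c \<Rightarrow> real" and mu :: "'s \<Rightarrow> real"
  assumes lam_pos: "\<And>c. 0 < lam c" and mu_pos: "\<And>s. 0 < mu s"
begin

definition rate :: "'c + 's \<Rightarrow> real" where
  "rate = case_sum lam mu"

definition srv :: "'c set \<Rightarrow> real" where
  "srv C = sum mu (compatible_servers E C)"

text \<open>\<open>C\<close> collects the types already passed, which permits induction from the
  head of the queue; \<open>C = {}\<close> gives the product form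
  (\<open>prod_eq_weight\<close>).\<close>

fun weight :: "'c set \<Rightarrow> 'c list \<Rightarrow> real" where
  "weight C [] = 1"
| "weight C (c # q) = lam c / srv (insert c C) * weight (insert c C) q"

definition stable :: bool where
  "stable \<longleftrightarrow> (\<forall>C. C \<noteq> {} \<longrightarrow> sum lam C < srv C)"

lemma rate_pos: "0 < rate k"
  using lam_pos mu_pos by (cases k) (auto simp: rate_def)

lemma sum_rate: "(\<Sum>k\<in>UNIV. rate k * g k) =
  (\<Sum>c\<in>UNIV. lam c * g (Inl c)) + (\<Sum>s\<in>UNIV. mu s * g (Inr s))"
  unfolding UNIV_Plus_UNIV[symmetric] by (subst sum.Plus) (auto simp: rate_def)

lemma sum_rate_pos: "0 < sum rate UNIV"
  using rate_pos by (intro sum_pos) auto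

lemma pmf_letter_rate: "pmf (letter_pmf rate) k = rate k / sum rate UNIV"
  by (rule pmf_letter_pmf) (rule rate_pos)

lemma srv_empty: "srv {} = 0"
  by (simp add: srv_def compatible_servers_def)

lemma srv_nonneg: "0 \<le> srv C"
  unfolding srv_def using mu_pos by (intro sum_nonneg) (auto intro: less_imp_le)

lemma srv_pos: "stable \<Longrightarrow> C \<noteq> {} \<Longrightarrow> 0 < srv C"
  unfolding stable_def using lam_pos
  by (metis less_imp_le order_le_less_trans sum_nonneg)

lemma compatible_servers_insert:
  "compatible_servers E (insert c C) = {s. (s, c) \<in> E} \<union> compatible_servers E C"
  by (auto simp: compatible_servers_def)

lemma weight_nonneg: "0 \<le> weight C q"
  by (induction q arbitrary: C) (auto simp: lam_pos less_imp_le srv_nonneg)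

lemma weight_pos: "stable \<Longrightarrow> 0 < weight C q"
  by (induction q arbitrary: C) (auto simp: lam_pos srv_pos)

lemma prod_eq_weight:
  "(\<Prod>l<length q. lam (q ! l) / srv (C \<union> set (take (Suc l) q))) = weight C q"
proof (induction q arbitrary: C)
  case (Cons c q)
  have "(\<Prod>l<length (c # q). lam ((c # q) ! l) / srv (C \<union> set (take (Suc l) (c # q)))) =
     lam c / srv (insert c C) * (\<Prod>l<length q. lam (q ! l) / srv (insert c C \<union> set (take (Suc l) q)))"
    unfolding length_Cons by (subst prod.lessThan_Suc_shift) (simp add: insert_commute)
  then show ?case unfolding Cons.IH by simp
qed simp

lemma weight_snoc: "weight C (q @ [c]) = weight C q * (lam c / srv (C \<union> insert c (set q)))"
  by (induction q arbitrary: C) (auto simp: insert_commute)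

section \<open>Partial balance for the product form\<close>

fun preimages :: "'s \<Rightarrow> 'c list \<Rightarrow> 'c list set" where
  "preimages s [] = insert [] ((\<lambda>c. [c]) ` {c. (s, c) \<in> E})"
| "preimages s (d # q) = (\<lambda>c. c # d # q) ` {c. (s, c) \<in> E} \<union>
     (if (s, d) \<in> E then {} else (#) d ` preimages s q)"

lemma preimages_iff: "x \<in> preimages s q \<longleftrightarrow> remove_served E s x = q"
proof (induction q arbitrary: x)
  case Nil
  show ?case by (cases x) auto
next
  case (Cons d q)
  then show ?case by (cases x) (auto split: if_splits)
qed

lemma finite_preimages: "finite (preimages s q)"
  by (induction q) auto

lemma sum_preimages_Nil:
  "(\<Sum>x\<in>preimages s []. weight C x) = 1 + (\<Sum>c\<in>{c. (s, c) \<in> E}. weight C [c])"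
  by (simp, subst sum.insert) (auto simp: sum.reindex inj_on_def)

lemma sum_preimages_Cons:
  "(\<Sum>x\<in>preimages s (d # q). weight C x) =
    (\<Sum>c\<in>{c. (s, c) \<in> E}. weight C (c # d # q)) +
    (if (s, d) \<in> E then 0
     else lam d / srv (insert d C) * (\<Sum>x\<in>preimages s q. weight (insert d C) x))"
proof -
  have "(\<Sum>x\<in>preimages s (d # q). weight C x) =
      (\<Sum>x\<in>(\<lambda>c. c # d # q) ` {c. (s, c) \<in> E}. weight C x) +
      (\<Sum>x\<in>(if (s, d) \<in> E then {} else (#) d ` preimages s q). weight C x)"
    unfolding preimages.simps by (rule sum.union_disjoint) (auto simp: finite_preimages)
  also have "(\<Sum>x\<in>(\<lambda>c. c # d # q) ` {c. (s, c) \<in> E}. weight C x) =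
      (\<Sum>c\<in>{c. (s, c) \<in> E}. weight C (c # d # q))"
    by (subst sum.reindex) (auto simp: inj_on_def)
  also have "(\<Sum>x\<in>(if (s, d) \<in> E then {} else (#) d ` preimages s q). weight C x) =
     (if (s, d) \<in> E then 0
     else lam d / srv (insert d C) * (\<Sum>x\<in>preimages s q. weight (insert d C) x))"
    by (simp add: sum.reindex sum_distrib_left)
  finally show ?thesis .
qed

text \<open>After the exchange of sums, \<open>g c\<close> is weighted by the servers that
  \<open>c\<close> adds to those of \<open>C\<close>, and their total rate is
  \<open>srv (insert c C) - srv C\<close>.\<close>

lemma sum_incompatible_swap:
  "(\<Sum>s\<in>-compatible_servers E C. mu s * (\<Sum>c\<in>{c. (s, c) \<in> E}. g c)) =
   (\<Sum>c\<in>UNIV. (srv (insert c C) - srv C) * g c)"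
proof -
  have "(\<Sum>s\<in>-compatible_servers E C. mu s * (\<Sum>c\<in>{c. (s, c) \<in> E}. g c)) =
     (\<Sum>s\<in>-compatible_servers E C. \<Sum>c\<in>UNIV. if (s, c) \<in> E then mu s * g c else 0)"
    by (intro sum.cong refl) (simp add: sum_distrib_left sum.If_cases)
  also have "\<dots> = (\<Sum>c\<in>UNIV. \<Sum>s\<in>-compatible_servers E C. if (s, c) \<in> E then mu s * g c else 0)"
    by (rule sum.swap)
  also have "\<dots> = (\<Sum>c\<in>UNIV. (srv (insert c C) - srv C) * g c)"
  proof (intro sum.cong refl)
    fix c
    have "srv (insert c C) = srv C + sum mu ({s. (s, c) \<in> E} - compatible_servers E C)"
      unfolding srv_def compatible_servers_insert
      by (subst sum.union_disjoint[symmetric]) (auto intro!: sum.cong)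
    moreover have "(\<Sum>s\<in>-compatible_servers E C. if (s, c) \<in> E then mu s * g c else 0) =
      sum mu ({s. (s, c) \<in> E} - compatible_servers E C) * g c"
      by (simp add: sum.If_cases sum_distrib_right Diff_eq Int_commute)
    ultimately show "(\<Sum>s\<in>-compatible_servers E C. if (s, c) \<in> E then mu s * g c else 0) =
      (srv (insert c C) - srv C) * g c" by simp
  qed
  finally show ?thesis .
qed

text \<open>
  Partial balance.  The correction \<open>srv C * weight C (c # q)\<close>, which vanishes for \<open>C = {}\<close>,
  makes the telescoping sum over the possible positions of the removed customer inductive.
\<close>

lemma server_balance:
  assumes stable
  shows "(\<Sum>s\<in>-compatible_servers E C. mu s * (\<Sum>x\<in>preimages s q. weight C x)) =
    (\<Sum>c\<in>UNIV. lam c * weight C q - srv C * weight C (c # q)) +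
    sum mu (-compatible_servers E (C \<union> set q)) * weight C q"
proof (induction q arbitrary: C)
  case Nil
  have "(\<Sum>s\<in>-compatible_servers E C. mu s * (\<Sum>x\<in>preimages s []. weight C x)) =
    sum mu (-compatible_servers E C) + (\<Sum>c\<in>UNIV. (srv (insert c C) - srv C) * weight C [c])"
    unfolding sum_preimages_Nil distrib_left sum.distrib sum_incompatible_swap by simp
  also have "(\<Sum>c\<in>UNIV. (srv (insert c C) - srv C) * weight C [c]) =
     (\<Sum>c\<in>UNIV. lam c * weight C [] - srv C * weight C (c # []))"
    using srv_pos[OF assms] by (intro sum.cong) (auto simp: field_simps less_imp_neq[symmetric])
  finally show ?case by simp
next
  case (Cons d q)
  let ?D = "insert d C"
  have D: "0 < srv ?D" using srv_pos[OF assms] by simp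
  have "(\<Sum>s\<in>-compatible_servers E C. mu s * (\<Sum>x\<in>preimages s (d # q). weight C x)) =
    (\<Sum>c\<in>UNIV. (srv (insert c C) - srv C) * weight C (c # d # q)) +
    (\<Sum>s\<in>-compatible_servers E C. if (s, d) \<in> E then 0
      else lam d / srv ?D * (mu s * (\<Sum>x\<in>preimages s q. weight ?D x)))"
    unfolding sum_preimages_Cons distrib_left sum.distrib sum_incompatible_swap
    by (intro arg_cong2[where f="(+)"] refl sum.cong) auto
  \<comment> \<open>A server compatible with \<open>d\<close> cannot have served anyone behind
    \<open>d\<close>; the remaining servers are those of the induction hypothesis for
    \<open>?D\<close>.\<close>
  also have "(\<Sum>s\<in>-compatible_servers E C. if (s, d) \<in> E then 0
      else lam d / srv ?D * (mu s * (\<Sum>x\<in>preimages s q. weight ?D x))) =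
     (\<Sum>s\<in>-compatible_servers E ?D. lam d / srv ?D * (mu s * (\<Sum>x\<in>preimages s q. weight ?D x)))"
    by (intro sum.mono_neutral_cong_right) (auto simp: compatible_servers_insert)
  also have "\<dots> = lam d / srv ?D * ((\<Sum>c\<in>UNIV. lam c * weight ?D q - srv ?D * weight ?D (c # q)) +
    sum mu (-compatible_servers E (?D \<union> set q)) * weight ?D q)"
    unfolding sum_distrib_left[symmetric] Cons.IH ..
  also have "\<dots> = (\<Sum>c\<in>UNIV. lam c * weight C (d # q) - srv (insert c C) * weight C (c # d # q)) +
     sum mu (-compatible_servers E (C \<union> set (d # q))) * weight C (d # q)"
    (is "_ = ?S + _")
  proof -
    have "lam d / srv ?D * (lam c * weight ?D q - srv ?D * weight ?D (c # q)) =
        lam c * weight C (d # q) - srv (insert c C) * weight C (c # d # q)" for c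
    proof -
      have "lam d / srv ?D * (srv ?D * weight ?D (c # q)) = lam d * weight ?D (c # q)"
        using D by simp
      \<comment> \<open>Exchanging the two head customers alters only the denominator of the first
        factor, as both orders lead to the same set of passed types.\<close>
      also have "\<dots> = srv (insert c C) * weight C (c # d # q)"
        using srv_pos[OF assms, of "insert c C"] by (simp add: insert_commute)
      finally show ?thesis by (simp add: right_diff_distrib)
    qed
    then show ?thesis
      by (simp only: distrib_left sum_distrib_left) (simp add: mult_ac)
  qed
  \<comment> \<open>Here the sum telescopes: the terms with \<open>srv (insert c C)\<close> cancel
    and only the correction with \<open>srv C\<close> survives.\<close>
  also have "(\<Sum>c\<in>UNIV. (srv (insert c C) - srv C) * weight C (c # d # q)) + (?S + 
     sum mu (-compatible_servers E (C \<union> set (d # q))) * weight C (d # q)) =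
     (\<Sum>c\<in>UNIV. lam c * weight C (d # q) - srv C * weight C (c # d # q)) +
     sum mu (-compatible_servers E (C \<union> set (d # q))) * weight C (d # q)"
    unfolding add.assoc[symmetric] sum.distrib[symmetric]
    by (intro arg_cong2[where f="(+)"] refl sum.cong) (simp add: left_diff_distrib del: weight.simps)
  finally show ?case .
qed

lemma finite_step_preimage: "finite {x. queue_step E k x = q}"
proof (cases k)
  case (Inl c)
  have "{x. queue_step E k x = q} \<subseteq> {butlast q}" using Inl by auto
  then show ?thesis by (rule finite_subset) simp
next
  case (Inr s)
  then have "{x. queue_step E k x = q} = preimages s q" by (auto simp: preimages_iff)
  then show ?thesis by (simp add: finite_preimages)
qed

text \<open>Fact \<open>1\<close> is the flow into \<open>q\<close> by customer arrivals, fact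
  \<open>2\<close> the flow by servers. Servers who find nobody compatible are self-loops of the
  letter chain and occur on both sides.\<close>

lemma weight_invariant:
  assumes stable
  shows "(\<Sum>k\<in>UNIV. rate k * (\<Sum>x\<in>{x. queue_step E k x = q}. weight {} x)) =
    sum rate UNIV * weight {} q"
proof -
  have 1: "(\<Sum>c\<in>UNIV. lam c * (\<Sum>x\<in>{x. queue_step E (Inl c) x = q}. weight {} x)) =
    srv (set q) * weight {} q"
  proof (cases q rule: rev_cases)
    case Nil
    then show ?thesis by (simp add: srv_empty)
  next
    case (snoc y d)
    have "(\<Sum>c\<in>UNIV. lam c * (\<Sum>x\<in>{x. queue_step E (Inl c) x = q}. weight {} x)) =
      (\<Sum>c\<in>UNIV. if c = d then lam d * weight {} y else 0)"
    proof (intro sum.cong refl)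
      fix c
      have "{x. queue_step E (Inl c) x = q} = (if c = d then {y} else {})"
        using snoc by auto
      then show "lam c * (\<Sum>x\<in>{x. queue_step E (Inl c) x = q}. weight {} x) =
        (if c = d then lam d * weight {} y else 0)" by simp
    qed
    also have "\<dots> = srv (set q) * weight {} q"
      using snoc srv_pos[OF assms, of "set q"] by (simp add: weight_snoc)
    finally show ?thesis .
  qed
  have 2: "(\<Sum>s\<in>UNIV. mu s * (\<Sum>x\<in>{x. queue_step E (Inr s) x = q}. weight {} x)) =
    sum lam UNIV * weight {} q + sum mu (-compatible_servers E (set q)) * weight {} q"
  proof -
    have "compatible_servers E {} = {}" by (simp add: compatible_servers_def)
    moreover have "{x. queue_step E (Inr s) x = q} = preimages s q" for s
      by (auto simp: preimages_iff)
    ultimately show ?thesis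
      using server_balance[OF assms, of "{}" q] by (simp add: srv_empty sum_distrib_right)
  qed
  have 3: "sum rate UNIV = sum lam UNIV + (srv (set q) + sum mu (-compatible_servers E (set q)))"
  proof -
    have "sum mu UNIV = srv (set q) + sum mu (-compatible_servers E (set q))"
      unfolding srv_def by (subst sum.union_disjoint[symmetric]) (auto intro!: sum.cong)
    then show ?thesis using sum_rate[of "\<lambda>_. 1"] by simp
  qed
  show ?thesis
    unfolding sum_rate 1 2 3 by (simp add: algebra_simps)
qed

section \<open>Summability of the weights and the stationary law of the discrete chain\<close>

lemma finite_bounded_lists: "finite {q :: 'c list. length q \<le> n}"
  using finite_lists_length_le[of "UNIV :: 'c set" n] by simp

lemma weight_sum_Suc:
  "(\<Sum>q\<in>{q. length q \<le> Suc n}. weight C q) =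
    1 + (\<Sum>c\<in>UNIV. lam c / srv (insert c C) * (\<Sum>q\<in>{q. length q \<le> n}. weight (insert c C) q))"
proof -
  have eq: "{q :: 'c list. length q \<le> Suc n} =
      insert [] (case_prod (#) ` (UNIV \<times> {q. length q \<le> n}))"
    by (auto simp: image_iff) (metis length_Cons Suc_le_mono neq_Nil_conv)
  have "(\<Sum>q\<in>{q. length q \<le> Suc n}. weight C q) =
      1 + (\<Sum>q\<in>case_prod (#) ` (UNIV \<times> {q :: 'c list. length q \<le> n}). weight C q)"
    unfolding eq by (subst sum.insert) (auto simp: finite_bounded_lists)
  also have "(\<Sum>q\<in>case_prod (#) ` (UNIV \<times> {q :: 'c list. length q \<le> n}). weight C q) =
     (\<Sum>(c, q)\<in>UNIV \<times> {q. length q \<le> n}. weight C (c # q))"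
    by (subst sum.reindex) (auto simp: inj_on_def intro!: sum.cong)
  also have "\<dots> = (\<Sum>c\<in>UNIV. lam c / srv (insert c C) * (\<Sum>q\<in>{q. length q \<le> n}. weight (insert c C) q))"
    by (simp add: sum.cartesian_product[symmetric] sum_distrib_left)
  finally show ?thesis .
qed

text \<open>Split by the type of the first customer. A type outside \<open>C\<close> enlarges
  \<open>C\<close> and is covered by induction; the types in \<open>C\<close> reproduce the same sum
  for shorter queues with total factor \<open>\<rho>\<close>, which stability makes less than 1. The
  bound \<open>K / (1 - \<rho>)\<close> is the fixed point of the resulting recursion.\<close>

lemma weight_sum_bounded:
  assumes stable
  shows "\<exists>B\<ge>0. \<forall>n. (\<Sum>q\<in>{q. length q \<le> n}. weight C q) \<le> B"
proof (induction "card (- C)" arbitrary: C rule: less_induct)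
  case less
  have "\<exists>B\<ge>0. \<forall>n. (\<Sum>q\<in>{q. length q \<le> n}. weight (insert c C) q) \<le> B" if "c \<notin> C" for c
    using that by (intro less psubset_card_mono) auto
  then obtain B where B: "\<And>c. c \<notin> C \<Longrightarrow> 0 \<le> B c"
    "\<And>c n. c \<notin> C \<Longrightarrow> (\<Sum>q\<in>{q. length q \<le> n}. weight (insert c C) q) \<le> B c" by metis
  define K where "K = 1 + (\<Sum>c\<in>-C. lam c / srv (insert c C) * B c)"
  \<comment> \<open>For \<open>C = {}\<close> this is \<open>0 / 0 = 0\<close>, as it should be: no
    first customer has its type in \<open>C\<close>.\<close>
  define \<rho> where "\<rho> = sum lam C / srv C"
  have K: "1 \<le> K"
    unfolding K_def using B(1) by (auto intro!: sum_nonneg simp: lam_pos less_imp_le srv_nonneg)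
  have \<rho>0: "0 \<le> \<rho>" unfolding \<rho>_def
    by (auto intro!: divide_nonneg_nonneg sum_nonneg simp: lam_pos less_imp_le srv_nonneg)
  have \<rho>: "\<rho> < 1"
  proof (cases "C = {}")
    case False
    then have "sum lam C < srv C" using assms unfolding stable_def by blast
    then show ?thesis unfolding \<rho>_def using srv_pos[OF assms False] by simp
  qed (simp add: \<rho>_def)
  have rec: "(\<Sum>q\<in>{q. length q \<le> Suc n}. weight C q) \<le> K + \<rho> * (\<Sum>q\<in>{q. length q \<le> n}. weight C q)" for n
  proof -
    let ?t = "\<lambda>c. lam c / srv (insert c C) * (\<Sum>q\<in>{q. length q \<le> n}. weight (insert c C) q)"
    have "(\<Sum>c\<in>UNIV. ?t c) = (\<Sum>c\<in>-C. ?t c) + (\<Sum>c\<in>C. ?t c)"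
      by (subst sum.union_disjoint[symmetric]) (auto intro!: sum.cong)
    also have "(\<Sum>c\<in>C. ?t c) = \<rho> * (\<Sum>q\<in>{q. length q \<le> n}. weight C q)"
      unfolding \<rho>_def sum_divide_distrib sum_distrib_right
      by (intro sum.cong) (auto simp: insert_absorb)
    also have "(\<Sum>c\<in>-C. ?t c) \<le> (\<Sum>c\<in>-C. lam c / srv (insert c C) * B c)"
      using B by (intro sum_mono mult_left_mono) (auto simp: lam_pos less_imp_le srv_nonneg)
    finally show ?thesis unfolding weight_sum_Suc K_def by simp
  qed
  have "(\<Sum>q\<in>{q. length q \<le> n}. weight C q) \<le> K / (1 - \<rho>)" for n
  proof (induction n)
    case 0
    have "K \<ge> 1 - \<rho>" using K \<rho>0 by simp
    then show ?case using \<rho> by simp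
  next
    case (Suc n)
    have "(\<Sum>q\<in>{q. length q \<le> Suc n}. weight C q) \<le> K + \<rho> * (K / (1 - \<rho>))"
      by (rule order_trans[OF rec]) (intro add_left_mono mult_left_mono Suc \<rho>0)
    also have "\<dots> = K / (1 - \<rho>)" using \<rho> by (simp add: field_simps)
    finally show ?case .
  qed
  moreover have "0 \<le> K / (1 - \<rho>)" using K \<rho> by simp
  ultimately show ?case by blast
qed

lemma weight_summable:
  assumes stable
  shows "weight {} summable_on UNIV"
proof -
  obtain B where B: "\<And>n. (\<Sum>q\<in>{q. length q \<le> n}. weight {} q) \<le> B"
    using weight_sum_bounded[OF assms] by blast
  show ?thesis
  proof (rule nonneg_bdd_above_summable_on)
    have "sum (weight {}) F \<le> B" if "finite F" for F
    proof -
      have "F \<subseteq> {q. length q \<le> Max (length ` F)}"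
        using that by auto
      then have "sum (weight {}) F \<le> sum (weight {}) {q. length q \<le> Max (length ` F)}"
        by (intro sum_mono2) (auto simp: finite_bounded_lists weight_nonneg)
      then show ?thesis using B order_trans by blast
    qed
    then show "bdd_above (sum (weight {}) ` {F. F \<subseteq> UNIV \<and> finite F})"
      by (intro bdd_aboveI[of _ B]) auto
  qed (simp add: weight_nonneg)
qed

definition equilibrium :: "'c list pmf" where
  "equilibrium = embed_pmf (\<lambda>q. inverse (infsum (weight {}) UNIV) * weight {} q)"

lemma infsum_weight_pos:
  assumes stable
  shows "0 < infsum (weight {}) UNIV"
proof -
  have "sum (weight {}) {[]} \<le> infsum (weight {}) UNIV"
    using weight_summable[OF assms] by (intro finite_sum_le_infsum) (auto simp: weight_nonneg)
  then show ?thesis by simp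
qed

lemma pmf_equilibrium:
  assumes stable
  shows "pmf equilibrium q = inverse (infsum (weight {}) UNIV) * weight {} q"
  unfolding equilibrium_def
proof (rule pmf_embed_pmf)
  note pos = infsum_weight_pos[OF assms]
  show "0 \<le> inverse (infsum (weight {}) UNIV) * weight {} q" for q
    using pos by (simp add: weight_nonneg)
  have "((\<lambda>q. inverse (infsum (weight {}) UNIV) * weight {} q) has_sum
      inverse (infsum (weight {}) UNIV) * infsum (weight {}) UNIV) UNIV"
    using weight_summable[OF assms] by (intro has_sum_cmult_right) simp
  then have "((\<lambda>q. inverse (infsum (weight {}) UNIV) * weight {} q) has_sum 1) UNIV"
    using pos by simp
  then show "(\<integral>\<^sup>+q. ennreal (inverse (infsum (weight {}) UNIV) * weight {} q) \<partial>count_space UNIV) = 1"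
    using pos by (subst (asm) has_sum_iff_nn_integral) (auto simp: weight_nonneg)
qed

lemma pmf_equilibrium_pos: "stable \<Longrightarrow> 0 < pmf equilibrium q"
  by (simp add: pmf_equilibrium infsum_weight_pos weight_pos)

lemma equilibrium_invariant:
  assumes stable
  shows "bind_pmf equilibrium (\<lambda>x. map_pmf (\<lambda>k. queue_step E k x) (letter_pmf rate)) = equilibrium"
proof (rule pmf_eqI)
  fix q
  let ?p = "letter_pmf rate" and ?Z = "inverse (infsum (weight {}) UNIV)"
  have map: "map_pmf (\<lambda>k. queue_step E k x) ?p = bind_pmf ?p (\<lambda>k. return_pmf (queue_step E k x))" for x
    by (simp add: map_pmf_def)
  have "ennreal (pmf (bind_pmf equilibrium (\<lambda>x. map_pmf (\<lambda>k. queue_step E k x) ?p)) q) =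
      ennreal (pmf (bind_pmf ?p (\<lambda>k. map_pmf (queue_step E k) equilibrium)) q)"
    unfolding map_pmf_def by (subst bind_commute_pmf) simp
  also have "\<dots> = (\<Sum>k\<in>UNIV. ennreal (pmf ?p k) * ennreal (pmf (map_pmf (queue_step E k) equilibrium) q))"
    by (simp add: ennreal_pmf_bind nn_integral_measure_pmf nn_integral_count_space_finite)
  also have "\<dots> = ennreal (\<Sum>k\<in>UNIV. pmf ?p k * pmf (map_pmf (queue_step E k) equilibrium) q)"
    by (simp flip: ennreal_mult add: sum_ennreal)
  finally have "pmf (bind_pmf equilibrium (\<lambda>x. map_pmf (\<lambda>k. queue_step E k x) ?p)) q =
      (\<Sum>k\<in>UNIV. pmf ?p k * pmf (map_pmf (queue_step E k) equilibrium) q)"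
    by (subst (asm) ennreal_inj) (auto intro!: sum_nonneg)
  also have "\<dots> = (\<Sum>k\<in>UNIV. ?Z / sum rate UNIV * (rate k * (\<Sum>x\<in>{x. queue_step E k x = q}. weight {} x)))"
  proof (intro sum.cong refl)
    fix k
    have "pmf (map_pmf (queue_step E k) equilibrium) q = measure_pmf.prob equilibrium {x. queue_step E k x = q}"
      by (simp add: pmf_map vimage_def)
    also have "\<dots> = ?Z * (\<Sum>x\<in>{x. queue_step E k x = q}. weight {} x)"
      by (simp add: measure_measure_pmf_finite finite_step_preimage pmf_equilibrium[OF assms] sum_distrib_left)
    finally show "pmf ?p k * pmf (map_pmf (queue_step E k) equilibrium) q =
        ?Z / sum rate UNIV * (rate k * (\<Sum>x\<in>{x. queue_step E k x = q}. weight {} x))"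
      by (simp add: pmf_letter_rate)
  qed
  also have "\<dots> = pmf equilibrium q"
    unfolding sum_distrib_left[symmetric] weight_invariant[OF assms]
    using sum_rate_pos by (simp add: pmf_equilibrium[OF assms])
  finally show "pmf (bind_pmf equilibrium (\<lambda>x. map_pmf (\<lambda>k. queue_step E k x) ?p)) q = pmf equilibrium q" .
qed

lemma equilibrium_invariant_word:
  assumes stable
  shows "bind_pmf equilibrium (\<lambda>x. map_pmf (\<lambda>w. fold (queue_step E) w x) (replicate_pmf n (letter_pmf rate))) =
    equilibrium"
proof (induction n)
  case 0
  then show ?case by (simp add: map_return_pmf bind_return_pmf')
next
  case (Suc n)
  let ?p = "letter_pmf rate"
  have "bind_pmf equilibrium (\<lambda>x. map_pmf (\<lambda>w. fold (queue_step E) w x) (replicate_pmf (Suc n) ?p)) =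
     bind_pmf (bind_pmf equilibrium (\<lambda>x. map_pmf (\<lambda>k. queue_step E k x) ?p))
       (\<lambda>x. map_pmf (\<lambda>w. fold (queue_step E) w x) (replicate_pmf n ?p))"
    by (simp add: map_pmf_def bind_assoc_pmf bind_return_pmf)
  then show ?case using equilibrium_invariant[OF assms] Suc by simp
qed

text \<open>By the FCFS rule a server compatible with the head of the queue serves the head, so one
  such server per customer, in queue order, empties the queue.\<close>

lemma reach_empty:
  assumes "\<And>c. \<exists>s. (s, c) \<in> E"
  shows "\<exists>w. fold (queue_step E) w q = []"
proof (induction q)
  case (Cons c q)
  obtain w where w: "fold (queue_step E) w q = []" using Cons by blast
  obtain s where "(s, c) \<in> E" using assms by blast
  then have "fold (queue_step E) (Inr s # w) (c # q) = []" using w by simp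
  then show ?case by blast
qed (auto intro: exI[of _ "[]"])

lemma fold_arrivals: "fold (queue_step E) (map Inl q) x = x @ q"
  by (induction q arbitrary: x) auto

lemma reachable:
  assumes "\<And>c. \<exists>s. (s, c) \<in> E"
  shows "\<exists>w. fold (queue_step E) w x = y"
proof -
  obtain w where "fold (queue_step E) w x = []" using reach_empty[OF assms] by blast
  then have "fold (queue_step E) (w @ map Inl y) x = y" by (simp add: fold_arrivals)
  then show ?thesis by blast
qed

lemma stable_compatible: "stable \<Longrightarrow> \<exists>s. (s, c) \<in> E"
  using srv_pos[of "{c}"] by (cases "\<exists>s. (s, c) \<in> E") (auto simp: srv_def compatible_servers_def)

section \<open>The load as a submartingale when stability fails\<close>

abbreviation load :: "'c set \<Rightarrow> 'c list \<Rightarrow> real" where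
  "load C q \<equiv> real (length (filter (\<lambda>c. c \<in> C) q))"

lemma load_remove_served:
  "load C q - of_bool (s \<in> compatible_servers E C) \<le> load C (remove_served E s q)"
  by (induction q) (auto simp: compatible_servers_def)

lemma length_remove_served: "length (remove_served E s q) \<le> length q"
  by (induction q) auto

lemma length_queue_step: "length (queue_step E k q) \<le> Suc (length q)"
  using length_remove_served by (cases k) (auto intro: le_SucI)

text \<open>Customers in \<open>C\<close> arrive at rate exactly \<open>sum lam C\<close>. They
  leave at rate at most \<open>srv C\<close>, because a server compatible with \<open>C\<close> may
  find no such customer or serve one outside \<open>C\<close> first.\<close>

lemma load_drift:
  assumes "srv C \<le> sum lam C"
  shows "load C q \<le> (\<Sum>k\<in>UNIV. pmf (letter_pmf rate) k * load C (queue_step E k q))"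
proof -
  have "(\<Sum>c\<in>UNIV. lam c * load C q) + sum lam C = (\<Sum>c\<in>UNIV. lam c * load C (queue_step E (Inl c) q))"
  proof -
    have "sum lam C = (\<Sum>c\<in>UNIV. lam c * of_bool (c \<in> C))"
      by (simp add: of_bool_def if_distrib sum.If_cases cong: if_cong)
    then have "(\<Sum>c\<in>UNIV. lam c * load C q) + sum lam C =
        (\<Sum>c\<in>UNIV. lam c * load C q + lam c * of_bool (c \<in> C))"
      by (simp add: sum.distrib)
    also have "\<dots> = (\<Sum>c\<in>UNIV. lam c * load C (queue_step E (Inl c) q))"
      by (intro sum.cong) (auto simp: distrib_left)
    finally show ?thesis .
  qed
  moreover have "(\<Sum>s\<in>UNIV. mu s * load C q) - srv C \<le> (\<Sum>s\<in>UNIV. mu s * load C (queue_step E (Inr s) q))"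
  proof -
    have "srv C = (\<Sum>s\<in>UNIV. mu s * of_bool (s \<in> compatible_servers E C))"
      unfolding srv_def by (simp add: of_bool_def if_distrib sum.If_cases cong: if_cong)
    then have "(\<Sum>s\<in>UNIV. mu s * load C q) - srv C =
        (\<Sum>s\<in>UNIV. mu s * (load C q - of_bool (s \<in> compatible_servers E C)))"
      by (simp only: right_diff_distrib sum_subtractf)
    also have "\<dots> \<le> (\<Sum>s\<in>UNIV. mu s * load C (queue_step E (Inr s) q))"
      using mu_pos load_remove_served by (intro sum_mono mult_left_mono) (auto intro: less_imp_le)
    finally show ?thesis .
  qed
  ultimately have "(\<Sum>k\<in>UNIV. rate k * load C q) \<le> (\<Sum>k\<in>UNIV. rate k * load C (queue_step E k q))"
    using assms unfolding sum_rate by linarith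
  then have "sum rate UNIV * load C q \<le> (\<Sum>k\<in>UNIV. rate k * load C (queue_step E k q))"
    by (simp add: sum_distrib_right)
  then have "load C q \<le> (\<Sum>k\<in>UNIV. rate k * load C (queue_step E k q)) / sum rate UNIV"
    using sum_rate_pos by (simp add: pos_le_divide_eq mult.commute)
  then show ?thesis by (simp add: pmf_letter_rate sum_divide_distrib)
qed

text \<open>
  The load is a nonnegative submartingale that vanishes in the empty state, so its expectation
  restricted to the paths avoiding \<open>[]\<close> does not decrease, whereas it is at most
  \<open>length q + m\<close> times the probability of these paths.
\<close>

fun avoid_load :: "'c set \<Rightarrow> nat \<Rightarrow> 'c list \<Rightarrow> real" where
  "avoid_load C 0 q = load C q"
| "avoid_load C (Suc m) q = (\<Sum>k\<in>UNIV. pmf (letter_pmf rate) k *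
     (if queue_step E k q = [] then 0 else avoid_load C m (queue_step E k q)))"

lemma load_le_avoid_load:
  assumes "srv C \<le> sum lam C"
  shows "load C q \<le> avoid_load C m q"
proof (induction m arbitrary: q)
  case (Suc m)
  have "load C q \<le> (\<Sum>k\<in>UNIV. pmf (letter_pmf rate) k * load C (queue_step E k q))"
    by (rule load_drift[OF assms])
  also have "\<dots> \<le> avoid_load C (Suc m) q"
    unfolding avoid_load.simps using Suc by (intro sum_mono mult_left_mono) auto
  finally show ?case .
qed simp

lemma avoid_load_le:
  "avoid_load C m q \<le> (length q + m) * avoid_prob (queue_step E) (letter_pmf rate) [] m q"
proof (induction m arbitrary: q)
  case 0
  show ?case by (simp add: length_filter_le)
next
  case (Suc m)
  let ?H = "avoid_prob (queue_step E) (letter_pmf rate) []"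
  have "avoid_load C (Suc m) q \<le> (\<Sum>k\<in>UNIV. pmf (letter_pmf rate) k *
     ((length q + Suc m) * (if queue_step E k q = [] then 0 else ?H m (queue_step E k q))))"
    unfolding avoid_load.simps
  proof (intro sum_mono mult_left_mono)
    fix k
    have "avoid_load C m (queue_step E k q) \<le> (length (queue_step E k q) + m) * ?H m (queue_step E k q)"
      by (rule Suc)
    also have "\<dots> \<le> (length q + Suc m) * ?H m (queue_step E k q)"
      using length_queue_step[of k q] by (intro mult_right_mono) (auto simp del: of_nat_add)
    finally show "(if queue_step E k q = [] then 0 else avoid_load C m (queue_step E k q)) \<le>
      (length q + Suc m) * (if queue_step E k q = [] then 0 else ?H m (queue_step E k q))"
      by simp
  qed simp
  also have "\<dots> = (length q + Suc m) * ?H (Suc m) q"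
    unfolding avoid_prob_Suc sum_distrib_left by (simp add: mult_ac)
  finally show ?case .
qed

text \<open>Let the first letter be a customer \<open>c\<close> from \<open>C\<close>, which costs
  the factor \<open>\<kappa>\<close>. From \<open>[c]\<close> the expected load never drops below 1
  although after \<open>m\<close> steps it is at most \<open>m + 1\<close>, so \<open>[]\<close> is
  avoided with probability at least \<open>1 / (m + 1)\<close>.\<close>

lemma no_return_prob_lower_bound:
  assumes "\<not> stable"
  shows "\<exists>\<kappa>>0. \<forall>m. \<kappa> / (m + 1) \<le> no_return_prob (queue_step E) (letter_pmf rate) [] m"
proof -
  obtain C c where C: "srv C \<le> sum lam C" and c: "c \<in> C"
    using assms unfolding stable_def by (auto simp: not_less)
  let ?p = "letter_pmf rate"
  let ?R = "no_return_prob (queue_step E) ?p []" and ?H = "avoid_prob (queue_step E) ?p []"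
  define \<kappa> where "\<kappa> = pmf ?p (Inl c)"
  have \<kappa>: "0 < \<kappa>" "\<kappa> \<le> 1"
    using rate_pos[of "Inl c"] sum_rate_pos pmf_le_1[of ?p "Inl c"] unfolding \<kappa>_def
    by (simp_all add: pmf_letter_rate)
  have H: "1 \<le> (m + 1) * ?H m [c]" for m
    using load_le_avoid_load[OF C, of "[c]" m] avoid_load_le[of C m "[c]"] c by (simp add: add.commute)
  have "\<kappa> / (m + 1) \<le> ?R m" for m
  proof (cases m)
    case 0
    then show ?thesis using \<kappa> by simp
  next
    case (Suc n)
    have "\<kappa> / (m + 1) \<le> \<kappa> / (n + 1)"
      using \<kappa> Suc by (intro divide_left_mono) auto
    also have "\<dots> \<le> \<kappa> * ?H n [c]"
    proof -
      have "\<kappa> * 1 \<le> \<kappa> * ((n + 1) * ?H n [c])"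
        using H[of n] \<kappa> by (intro mult_left_mono) (auto simp: add.commute)
      then show ?thesis by (simp add: pos_divide_le_eq mult_ac)
    qed
    also have "\<dots> = (\<Sum>k\<in>{Inl c}. pmf ?p k *
      (if queue_step E k [] = [] then ?R n else ?H n (queue_step E k [])))"
      by (simp add: \<kappa>_def)
    also have "\<dots> \<le> ?R (Suc n)"
      unfolding no_return_prob_Suc by (intro sum_mono2) auto
    finally show ?thesis using Suc by simp
  qed
  then show ?thesis using \<kappa> by blast
qed

end

section \<open>The queue in continuous time\<close>

locale fcfs_queue = matching_rates E lam mu + poisson_streams M "matching_rates.rate lam mu" A
  for M :: "'w measure" and E :: "('s::finite \<times> 'c::finite) set"
    and lam :: "'c \<Rightarrow> real" and mu :: "'s \<Rightarrow> real" and A :: "'c + 's \<Rightarrow> 'w \<Rightarrow> real set"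
begin

section \<open>Markov property and transition function\<close>

abbreviation queue :: "'c list \<Rightarrow> real \<Rightarrow> 'w \<Rightarrow> 'c list" where
  "queue \<equiv> matching_queue E A"

definition trans :: "real \<Rightarrow> 'c list \<Rightarrow> 'c list pmf" where
  "trans t x = map_pmf (\<lambda>w. fold (queue_step E) w x) (word_pmf rate t)"

lemma queue_eq: "queue x t \<omega> = fold (queue_step E) (word (\<lambda>k. A k \<omega>) 0 t) x"
  by (simp add: matching_queue_def arrival_word_eq)

lemma queue_0 [simp]: "queue x 0 \<omega> = x"
  by (simp add: queue_eq)

lemma queue_later:
  assumes "\<omega> \<in> space M" "0 \<le> s" "s \<le> t"
  shows "queue x t \<omega> = fold (queue_step E) (word (\<lambda>k. A k \<omega>) s t) (queue x s \<omega>)"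
  unfolding queue_eq using word_append[OF locally_finite_arrivals[OF assms(1)] assms(2,3)] by simp

text \<open>Given the state at \<open>s\<close>, the state at \<open>u\<close> is a function of the
  word over \<open>{s<..u}\<close>. \<open>B\<close> may record any further history, as the Markov
  property demands.\<close>

lemma past_queue:
  assumes B: "past s B" and x: "\<And>\<omega>. \<omega> \<in> B \<Longrightarrow> queue (X0 \<omega>) s \<omega> = x" and su: "0 \<le> s" "s \<le> u"
  shows "prob (B \<inter> {\<omega>\<in>space M. queue (X0 \<omega>) u \<omega> = y}) = prob B * pmf (trans (u - s) x) y"
    and "past u (B \<inter> {\<omega>\<in>space M. queue (X0 \<omega>) u \<omega> = y})"
proof -
  let ?T = "{w. fold (queue_step E) w x = y}"
  have eq: "B \<inter> {\<omega>\<in>space M. queue (X0 \<omega>) u \<omega> = y} = B \<inter> {\<omega>\<in>space M. word (\<lambda>k. A k \<omega>) s u \<in> ?T}"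
    using x queue_later[OF _ su] by auto
  show "prob (B \<inter> {\<omega>\<in>space M. queue (X0 \<omega>) u \<omega> = y}) = prob B * pmf (trans (u - s) x) y"
    unfolding eq past_word(1)[OF B su] by (simp add: trans_def pmf_map vimage_def)
  show "past u (B \<inter> {\<omega>\<in>space M. queue (X0 \<omega>) u \<omega> = y})"
    unfolding eq by (rule past_word(2)[OF B su])
qed

lemma past_queue_start:
  assumes X0: "\<And>q. past 0 {\<omega>\<in>space M. X0 \<omega> = q}" and t: "0 \<le> t"
  shows "past t {\<omega>\<in>space M. queue (X0 \<omega>) t \<omega> = x}"
proof -
  have "past t (\<Union>q. {\<omega>\<in>space M. X0 \<omega> = q} \<inter> {\<omega>\<in>space M. queue (X0 \<omega>) t \<omega> = x})"
  proof (rule past_union)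
    show "past t ({\<omega>\<in>space M. X0 \<omega> = q} \<inter> {\<omega>\<in>space M. queue (X0 \<omega>) t \<omega> = x})" for q
      using t by (intro past_queue(2)[OF X0, of q X0 q]) auto
  qed (auto simp: disjoint_family_on_def)
  also have "(\<Union>q. {\<omega>\<in>space M. X0 \<omega> = q} \<inter> {\<omega>\<in>space M. queue (X0 \<omega>) t \<omega> = x}) =
      {\<omega>\<in>space M. queue (X0 \<omega>) t \<omega> = x}" by auto
  finally show ?thesis .
qed

lemma past_const: "past 0 {\<omega>\<in>space M. x = q}"
proof (cases "x = q")
  case True
  then show ?thesis using past_space by simp
next
  case False
  then show ?thesis by (simp add: past_def)
qed

lemma transition_prob_eq:
  assumes "0 \<le> t"
  shows "transition_prob M queue t x y = pmf (trans t x) y"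
proof -
  have "space M \<inter> {\<omega>\<in>space M. queue x t \<omega> = y} = {\<omega>\<in>space M. queue x t \<omega> = y}" by auto
  then show ?thesis
    using past_queue(1)[OF past_space, of "\<lambda>_. x" x t y] assms
    by (simp add: transition_prob_def prob_space)
qed

text \<open>The Chapman-Kolmogorov equation is read off from the process by splitting according to
  the state at time \<open>s\<close>; this spares the convolution of the Poisson mixtures.\<close>

lemma trans_add:
  assumes "0 \<le> s" "0 \<le> t"
  shows "((\<lambda>y. pmf (trans s x) y * pmf (trans t y) z) has_sum pmf (trans (s + t) x) z) UNIV"
proof (subst has_sum_iff_nn_integral)
  let ?B = "\<lambda>y. {\<omega>\<in>space M. queue x s \<omega> = y}"
  let ?Z = "{\<omega>\<in>space M. queue x (s + t) \<omega> = z}"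
  have B: "past s (?B y)" for y
    using past_queue_start[OF past_const assms(1)] .
  have pB: "prob (?B y) = pmf (trans s x) y" for y
    using transition_prob_eq[OF assms(1), of x y] by (simp add: transition_prob_def)
  have BZ: "prob (?B y \<inter> ?Z) = pmf (trans s x) y * pmf (trans t y) z" for y
    using past_queue(1)[OF B, of y "\<lambda>_. x" y "s + t" z] assms pB by simp
  have ev: "?B y \<inter> ?Z \<in> events" for y
    using past_queue(2)[OF B, of y "\<lambda>_. x" y "s + t" z] assms by (auto dest: past_eventsD)
  have "(\<integral>\<^sup>+y. ennreal (pmf (trans s x) y * pmf (trans t y) z) \<partial>count_space UNIV) =
      (\<integral>\<^sup>+y. emeasure M (?B y \<inter> ?Z) \<partial>count_space UNIV)"
    by (simp add: BZ emeasure_eq_measure)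
  also have "\<dots> = emeasure M (\<Union>y. ?B y \<inter> ?Z)"
    using ev by (intro emeasure_UN_countable[symmetric]) (auto simp: disjoint_family_on_def)
  also have "(\<Union>y. ?B y \<inter> ?Z) = ?Z" by auto
  also have "emeasure M ?Z = ennreal (pmf (trans (s + t) x) z)"
    using transition_prob_eq[of "s + t" x z] assms by (simp add: transition_prob_def emeasure_eq_measure)
  finally show "(\<integral>\<^sup>+y. ennreal (pmf (trans s x) y * pmf (trans t y) z) \<partial>count_space UNIV) =
    ennreal (pmf (trans (s + t) x) z)" .
qed auto

lemma trans_0: "trans 0 x = return_pmf x"
  by (simp add: trans_def word_pmf_def map_return_pmf)

lemma trans_ge:
  assumes "fold (queue_step E) w x = y"
  shows "pmf (word_pmf rate t) w \<le> pmf (trans t x) y"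
  unfolding trans_def pmf_map using assms
  by (subst measure_pmf_single[symmetric]) (intro measure_pmf.finite_measure_mono, auto)

lemma trans_tendsto: "((\<lambda>t. pmf (trans t x) x) \<longlongrightarrow> 1) (at_right 0)"
proof (rule tendsto_sandwich)
  show "\<forall>\<^sub>F t in at_right 0. exp (- sum rate UNIV * t) \<le> pmf (trans t x) x"
    using eventually_at_right_less[of "0::real"]
  proof eventually_elim
    case (elim t)
    then show ?case using trans_ge[of "[]" x x t] by (simp add: pmf_word_pmf[OF r_pos])
  qed
  show "\<forall>\<^sub>F t in at_right 0. pmf (trans t x) x \<le> 1"
    by (simp add: pmf_le_1)
  show "((\<lambda>t. exp (- sum rate UNIV * t)) \<longlongrightarrow> 1) (at_right 0)"
    by (rule tendsto_eq_intros refl | simp)+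
qed auto

lemma transition_function_queue: "transition_function (transition_prob M queue)"
  unfolding transition_function_def
proof (intro conjI allI impI)
  fix x
  have "\<forall>\<^sub>F t in at_right 0. pmf (trans t x) x = transition_prob M queue t x x"
    using eventually_at_right_less[of "0::real"]
    by eventually_elim (simp add: transition_prob_eq)
  then show "((\<lambda>t. transition_prob M queue t x x) \<longlongrightarrow> 1) (at_right 0)"
    using trans_tendsto by (rule Lim_transform_eventually[rotated])
next
  show "transition_prob M queue 0 x y = of_bool (x = y)" for x y
    by (auto simp: transition_prob_eq trans_0)
  show "(transition_prob M queue t x has_sum 1) UNIV" if "0 \<le> t" for t x
  proof -
    have "transition_prob M queue t x = pmf (trans t x)"
      using that by (intro ext transition_prob_eq)
    then show ?thesis by (simp add: has_sum_pmf)
  qed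
qed (simp_all add: transition_prob_eq trans_add)

lemma markov_chain_queue:
  assumes X0: "\<And>q. past 0 {\<omega>\<in>space M. X0 \<omega> = q}"
  shows "markov_chain M (transition_prob M queue) (\<lambda>t \<omega>. queue (X0 \<omega>) t \<omega>)"
  unfolding markov_chain_def
proof (intro conjI allI impI)
  show "transition_function (transition_prob M queue)" by (rule transition_function_queue)
  show "(\<lambda>\<omega>. queue (X0 \<omega>) t \<omega>) \<in> measurable M (count_space UNIV)" if "0 \<le> t" for t
  proof (subst measurable_count_space_eq2_countable)
    have "(\<lambda>\<omega>. queue (X0 \<omega>) t \<omega>) -` {x} \<inter> space M \<in> events" for x
      using past_eventsD[OF past_queue_start[OF X0 that, of x]]
      by (simp add: vimage_def Int_def conj_commute)
    then show "(\<lambda>\<omega>. queue (X0 \<omega>) t \<omega>) \<in> space M \<rightarrow> UNIV \<and>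
      (\<forall>x\<in>UNIV. (\<lambda>\<omega>. queue (X0 \<omega>) t \<omega>) -` {x} \<inter> space M \<in> events)" by auto
  qed
  fix n :: nat and \<tau> x u y
  assume asm: "0 \<le> \<tau> 0 \<and> (\<forall>i<n. \<tau> i < \<tau> (Suc i)) \<and> \<tau> n < u \<and>
    0 < \<P>(\<omega> in M. \<forall>i\<le>n. queue (X0 \<omega>) (\<tau> i) \<omega> = x i)"
  let ?H = "\<lambda>n. {\<omega>\<in>space M. \<forall>i\<le>n. queue (X0 \<omega>) (\<tau> i) \<omega> = x i}"
  \<comment> \<open>Each history event belongs to the past of its last observation time, so
    observations can be added one at a time.\<close>
  have "0 \<le> \<tau> m \<and> past (\<tau> m) (?H m)" if "m \<le> n" for m
    using that
  proof (induction m)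
    case 0
    then show ?case using asm past_queue_start[OF X0, of "\<tau> 0" "x 0"] by simp
  next
    case (Suc m)
    then have \<tau>: "0 \<le> \<tau> m" "\<tau> m \<le> \<tau> (Suc m)" using asm by (auto intro: less_imp_le)
    have "past (\<tau> (Suc m)) (?H m \<inter> {\<omega>\<in>space M. queue (X0 \<omega>) (\<tau> (Suc m)) \<omega> = x (Suc m)})"
      using Suc \<tau> by (intro past_queue(2)[where x = "x m"]) auto
    moreover have "?H m \<inter> {\<omega>\<in>space M. queue (X0 \<omega>) (\<tau> (Suc m)) \<omega> = x (Suc m)} = ?H (Suc m)"
      by (auto simp: le_Suc_eq)
    ultimately show ?case using \<tau> by simp
  qed
  then have H: "past (\<tau> n) (?H n)" "0 \<le> \<tau> n" by auto
  have eq: "{\<omega>\<in>space M. queue (X0 \<omega>) u \<omega> = y \<and> (\<forall>i\<le>n. queue (X0 \<omega>) (\<tau> i) \<omega> = x i)} =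
      ?H n \<inter> {\<omega>\<in>space M. queue (X0 \<omega>) u \<omega> = y}" by auto
  have "prob (?H n \<inter> {\<omega>\<in>space M. queue (X0 \<omega>) u \<omega> = y}) = prob (?H n) * pmf (trans (u - \<tau> n) (x n)) y"
    using H asm by (intro past_queue(1)) auto
  then show "\<P>(\<omega> in M. queue (X0 \<omega>) u \<omega> = y \<bar> \<forall>i\<le>n. queue (X0 \<omega>) (\<tau> i) \<omega> = x i) =
      transition_prob M queue (u - \<tau> n) (x n) y"
    using asm by (simp add: cond_prob_def eq transition_prob_eq)
qed

section \<open>Irreducibility and the stationary distribution\<close>

lemma trans_positive:
  assumes "stable" "0 < t"
  shows "0 < pmf (trans t x) y"
proof -
  obtain w where w: "fold (queue_step E) w x = y"
    using reachable stable_compatible[OF assms(1)] by metis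
  have "0 < prod_list (map rate w)" by (induction w) (auto simp: rate_pos)
  then have "0 < pmf (word_pmf rate t) w"
    using assms by (simp add: pmf_word_pmf[OF r_pos])
  then show ?thesis using trans_ge[OF w, of t] by simp
qed

lemma irreducible_queue: "stable \<Longrightarrow> irreducible_chain (transition_prob M queue)"
  unfolding irreducible_chain_def by (intro allI exI[of _ 1]) (simp add: transition_prob_eq trans_positive)

lemma equilibrium_stationary:
  assumes "stable" "0 \<le> t"
  shows "bind_pmf equilibrium (trans t) = equilibrium"
proof (cases "t = 0")
  case True
  then show ?thesis by (simp add: trans_0 bind_return_pmf' cong: bind_pmf_cong)
next
  case False
  let ?K = "\<lambda>n x. map_pmf (\<lambda>w. fold (queue_step E) w x) (replicate_pmf n (letter_pmf rate))"
  have "bind_pmf equilibrium (trans t) =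
      bind_pmf equilibrium (\<lambda>x. bind_pmf (poisson_pmf (sum rate UNIV * t)) (\<lambda>n. ?K n x))"
    using False by (simp add: trans_def[abs_def] word_pmf_def map_bind_pmf)
  also have "\<dots> = bind_pmf (poisson_pmf (sum rate UNIV * t)) (\<lambda>n. bind_pmf equilibrium (?K n))"
    by (rule bind_commute_pmf)
  also have "\<dots> = equilibrium" by (simp add: equilibrium_invariant_word[OF assms(1)])
  finally show ?thesis .
qed

text \<open>For uniqueness, \<open>p\<close> is turned into a pmf and compared with
  \<open>equilibrium\<close> under the kernel at time 1, whose entries are all positive.\<close>

lemma stationary_distribution_iff:
  assumes stable
  shows "stationary_distribution (transition_prob M queue) p \<longleftrightarrow> p = pmf equilibrium"
proof
  assume "p = pmf equilibrium"
  moreover have "((\<lambda>x. pmf equilibrium x * transition_prob M queue t x y) has_sum pmf equilibrium y) UNIV"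
    if "0 \<le> t" for t y
    using has_sum_bind_pmf[of equilibrium "trans t" y] that
    by (simp add: equilibrium_stationary[OF assms] transition_prob_eq)
  ultimately show "stationary_distribution (transition_prob M queue) p"
    by (simp add: stationary_distribution_def has_sum_pmf)
next
  assume p: "stationary_distribution (transition_prob M queue) p"
  then have nonneg: "\<And>x. 0 \<le> p x" and sum: "(p has_sum 1) UNIV"
    by (auto simp: stationary_distribution_def)
  have pmf_p: "pmf (embed_pmf p) x = p x" for x
    using has_sum_iff_nn_integral[of p 1] nonneg sum by (intro pmf_embed_pmf) auto
  have "bind_pmf (embed_pmf p) (trans 1) = embed_pmf p"
  proof (rule pmf_eqI)
    fix y
    have "((\<lambda>x. p x * transition_prob M queue 1 x y) has_sum p y) UNIV"
      using p zero_le_one unfolding stationary_distribution_def by blast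
    then have "((\<lambda>x. p x * pmf (trans 1 x) y) has_sum p y) UNIV"
      by (simp add: transition_prob_eq)
    moreover have "((\<lambda>x. p x * pmf (trans 1 x) y) has_sum pmf (bind_pmf (embed_pmf p) (trans 1)) y) UNIV"
      using has_sum_bind_pmf[of "embed_pmf p" "trans 1" y] by (simp add: pmf_p)
    ultimately show "pmf (bind_pmf (embed_pmf p) (trans 1)) y = pmf (embed_pmf p) y"
      unfolding pmf_p by (rule has_sum_unique[symmetric])
  qed
  moreover have "bind_pmf equilibrium (trans 1) = equilibrium"
    using equilibrium_stationary[OF assms] by simp
  ultimately have "embed_pmf p = equilibrium"
    by (rule stationary_pmf_unique) (simp add: trans_positive[OF assms])
  then show "p = pmf equilibrium" using pmf_p by auto
qed

section \<open>Mean return times\<close>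

abbreviation no_return_event :: "'c list \<Rightarrow> nat \<Rightarrow> 'w set" where
  "no_return_event x n \<equiv> {\<omega>\<in>space M. no_return (queue_step E) x (word (\<lambda>k. A k \<omega>) 0 (real n))}"

lemma sets_no_return_event: "no_return_event x n \<in> events"
  using past_eventsD[OF past_word(2)[OF past_space, of "real n" "{w. no_return (queue_step E) x w}"]]
  by (simp add: Int_def)

lemma emeasure_no_return_event:
  assumes "0 < n"
  shows "emeasure M (no_return_event x n) =
    (\<integral>\<^sup>+m. no_return_prob (queue_step E) (letter_pmf rate) x m \<partial>poisson_pmf (sum rate UNIV * real n))"
proof -
  have "emeasure M (no_return_event x n) = emeasure (word_pmf rate n) {w. no_return (queue_step E) x w}"
    using prob_word[of "real n" "{w. no_return (queue_step E) x w}"]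
    by (simp add: emeasure_eq_measure measure_pmf.emeasure_eq_measure)
  also have "word_pmf rate n =
      bind_pmf (poisson_pmf (sum rate UNIV * real n)) (\<lambda>m. replicate_pmf m (letter_pmf rate))"
    using assms by (simp add: word_pmf_def)
  also have "emeasure \<dots> {w. no_return (queue_step E) x w} =
      (\<integral>\<^sup>+m. no_return_prob (queue_step E) (letter_pmf rate) x m
        \<partial>poisson_pmf (sum rate UNIV * real n))"
    unfolding emeasure_bind_pmf by (simp add: measure_pmf.emeasure_eq_measure)
  finally show ?thesis .
qed

text \<open>Holds on every path: two times \<open>s < t \<le> n\<close> always cut the word into
  consecutive pieces, even if arrivals coincide.\<close>

lemma return_time_ge:
  assumes "\<omega> \<in> no_return_event x n"
  shows "of_nat n \<le> return_time (queue x) x \<omega>"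
  unfolding return_time_def
proof (rule INF_greatest)
  fix t assume "t \<in> {t. 0 \<le> t \<and> queue x t \<omega> = x \<and> (\<exists>s. 0 \<le> s \<and> s < t \<and> queue x s \<omega> \<noteq> x)}"
  then obtain s where s: "0 \<le> s" "s < t" "queue x t \<omega> = x" "queue x s \<omega> \<noteq> x" by auto
  have \<omega>: "\<omega> \<in> space M" and nr: "no_return (queue_step E) x (word (\<lambda>k. A k \<omega>) 0 (real n))"
    using assms by auto
  note lf = locally_finite_arrivals[OF \<omega>]
  have "real n < t"
  proof (rule ccontr)
    assume "\<not> real n < t"
    then have "word (\<lambda>k. A k \<omega>) 0 (real n) =
        word (\<lambda>k. A k \<omega>) 0 s @ word (\<lambda>k. A k \<omega>) s t @ word (\<lambda>k. A k \<omega>) t (real n)"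
      using s word_append[OF lf, of 0 s n] word_append[OF lf, of s t n] by simp
    moreover have "queue x t \<omega> = fold (queue_step E) (word (\<lambda>k. A k \<omega>) 0 s @ word (\<lambda>k. A k \<omega>) s t) x"
      using s word_append[OF lf, of 0 s t] by (simp add: queue_eq)
    moreover from this have "word (\<lambda>k. A k \<omega>) s t \<noteq> []" using s by (auto simp: queue_eq)
    ultimately show False
      using nr[unfolded no_return_iff, rule_format,
          of "word (\<lambda>k. A k \<omega>) 0 s" "word (\<lambda>k. A k \<omega>) s t" "word (\<lambda>k. A k \<omega>) t (real n)"] s
      by (simp add: queue_eq)
  qed
  then show "of_nat n \<le> ennreal t"
    by (simp add: ennreal_of_nat_eq_real_of_nat ennreal_leI)
qed

text \<open>The converse turns prefixes of the word into times, which is possible when the arrivals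
  are separated (\<open>resolved_prefix\<close>).\<close>

lemma return_time_le:
  assumes \<omega>: "\<omega> \<in> space M" "\<omega> \<notin> no_return_event x n"
    and res: "resolved (\<lambda>k. A k \<omega>) 0 (real n) m"
  shows "return_time (queue x) x \<omega> \<le> of_nat n"
proof -
  note lf = locally_finite_arrivals[OF \<omega>(1)]
  let ?W = "word (\<lambda>k. A k \<omega>) 0"
  obtain u v z where uvz: "?W (real n) = u @ v @ z" "v \<noteq> []" "fold (queue_step E) u x \<noteq> x"
    "fold (queue_step E) (u @ v) x = x"
    using \<omega> by (auto simp: no_return_iff)
  obtain s :: real where s: "0 \<le> s" "s \<le> n" "?W s = u"
    using resolved_prefix[OF lf _ res uvz(1)] by auto
  obtain t :: real where t: "0 \<le> t" "t \<le> n" "?W t = u @ v"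
    using resolved_prefix[OF lf _ res, of "u @ v" z] uvz(1) by auto
  have "s < t"
  proof (rule ccontr)
    assume "\<not> s < t"
    then have "?W s = ?W t @ word (\<lambda>k. A k \<omega>) t s"
      using t by (intro word_append[OF lf]) auto
    then show False using s t uvz(2) by simp
  qed
  then have "t \<in> {t. 0 \<le> t \<and> queue x t \<omega> = x \<and> (\<exists>s. 0 \<le> s \<and> s < t \<and> queue x s \<omega> \<noteq> x)}"
    using s t uvz by (auto simp: queue_eq intro!: exI[of _ s])
  then show ?thesis
    unfolding return_time_def using t(2)
    by (intro INF_lower2[of t]) (auto simp: ennreal_of_nat_eq_real_of_nat intro: ennreal_leI)
qed

text \<open>A finite mean would dominate all partial sums of the probabilities of no return by time
  \<open>Suc n\<close>. Averaged over a Poisson number of letters, the discrete bound makes these at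
  least of order \<open>1 / n\<close>, so the harmonic series would converge.\<close>

lemma not_stable_imp_infinite_return_time:
  assumes "\<not> stable"
  shows "(\<integral>\<^sup>+\<omega>. return_time (queue []) [] \<omega> \<partial>M) = \<infinity>"
proof (rule ccontr)
  assume "(\<integral>\<^sup>+\<omega>. return_time (queue []) [] \<omega> \<partial>M) \<noteq> \<infinity>"
  then obtain C where C: "0 \<le> C" "(\<integral>\<^sup>+\<omega>. return_time (queue []) [] \<omega> \<partial>M) = ennreal C"
    by (cases "\<integral>\<^sup>+\<omega>. return_time (queue []) [] \<omega> \<partial>M") auto
  let ?L = "sum rate UNIV"
  obtain \<kappa> where \<kappa>: "0 < \<kappa>" "\<And>m. \<kappa> / (m + 1) \<le> no_return_prob (queue_step E) (letter_pmf rate) [] m"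
    using no_return_prob_lower_bound[OF assms] by auto
  \<comment> \<open>Comes from \<open>nn_integral_poisson_inverse_Suc\<close> with parameter
    \<open>?L * real (Suc n)\<close>, where the factor
    \<open>1 - exp (- (?L * real (Suc n)))\<close> is replaced by its least value, at
    \<open>n = 0\<close>.\<close>
  define \<kappa>' where "\<kappa>' = \<kappa> * (1 - exp (- ?L)) / ?L"
  have \<kappa>': "0 < \<kappa>'" unfolding \<kappa>'_def using \<kappa> sum_rate_pos by simp
  have ge: "ennreal (\<kappa>' / real (Suc n)) \<le> emeasure M (no_return_event [] (Suc n))" for n
  proof -
    have "\<kappa>' / real (Suc n) \<le> \<kappa> * (1 - exp (- (?L * real (Suc n)))) / (?L * real (Suc n))"
    proof -
      have "?L * 1 \<le> ?L * real (Suc n)" using sum_rate_pos by (intro mult_left_mono) auto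
      then have "\<kappa> * (1 - exp (- ?L)) \<le> \<kappa> * (1 - exp (- (?L * real (Suc n))))"
        using \<kappa> by (intro mult_left_mono) auto
      then have "\<kappa> * (1 - exp (- ?L)) / (?L * real (Suc n)) \<le>
          \<kappa> * (1 - exp (- (?L * real (Suc n)))) / (?L * real (Suc n))"
        using sum_rate_pos by (intro divide_right_mono) auto
      then show ?thesis by (simp add: \<kappa>'_def)
    qed
    then have "ennreal (\<kappa>' / real (Suc n)) \<le>
        (\<integral>\<^sup>+m. ennreal (\<kappa> / (real m + 1)) \<partial>poisson_pmf (?L * real (Suc n)))"
      using \<kappa> sum_rate_pos by (subst nn_integral_poisson_inverse_Suc) (auto intro: ennreal_leI)
    also have "\<dots> \<le> emeasure M (no_return_event [] (Suc n))"
      using \<kappa>(2) by (subst emeasure_no_return_event) (auto intro!: nn_integral_mono ennreal_leI simp: add.commute)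
    finally show ?thesis .
  qed
  have "(\<Sum>n<N. \<kappa>' / real (Suc n)) \<le> C" for N
  proof -
    have "ennreal (\<Sum>n<N. \<kappa>' / real (Suc n)) = (\<Sum>n<N. ennreal (\<kappa>' / real (Suc n)))"
      using \<kappa>' by (subst sum_ennreal) auto
    also have "\<dots> \<le> (\<Sum>n<N. emeasure M (no_return_event [] (Suc n)))"
      by (intro sum_mono ge)
    also have "\<dots> = (\<integral>\<^sup>+\<omega>. (\<Sum>n<N. indicator (no_return_event [] (Suc n)) \<omega>) \<partial>M)"
      using sets_no_return_event by (subst nn_integral_sum) (simp_all del: of_nat_Suc)
    also have "\<dots> \<le> (\<integral>\<^sup>+\<omega>. return_time (queue []) [] \<omega> \<partial>M)"
    proof (intro nn_integral_mono)
      fix \<omega>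
      \<comment> \<open>If \<open>m\<close> is the largest element of \<open>?S\<close>, then
        \<open>?S\<close> has at most \<open>m + 1\<close> elements, while no return by time
        \<open>m + 1\<close> makes the return time at least \<open>m + 1\<close>.\<close>
      let ?S = "{n\<in>{..<N}. \<omega> \<in> no_return_event [] (Suc n)}"
      have "(\<Sum>n<N. indicator (no_return_event [] (Suc n)) \<omega> :: ennreal) = of_nat (card ?S)"
        by (simp add: indicator_def[abs_def] sum.If_cases of_bool_def Int_def)
      also have "\<dots> \<le> return_time (queue []) [] \<omega>"
      proof (cases "?S = {}")
        case False
        define m where "m = Max ?S"
        have "m \<in> ?S" unfolding m_def using False by (intro Max_in) simp_all
        then have m1: "\<omega> \<in> no_return_event [] (Suc m)" by simp
        have m2: "n \<le> m" if "n \<in> ?S" for n unfolding m_def using that by (intro Max_ge) simp_all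
        have "card ?S \<le> card {..m}" using m2 by (intro card_mono) blast+
        then have "card ?S \<le> Suc m" by simp
        then have "of_nat (card ?S) \<le> (of_nat (Suc m) :: ennreal)" by (rule of_nat_mono)
        also have "\<dots> \<le> return_time (queue []) [] \<omega>"
          by (rule return_time_ge[OF m1])
        finally show ?thesis .
      next
        case True
        show ?thesis unfolding True by simp
      qed
      finally show "(\<Sum>n<N. indicator (no_return_event [] (Suc n)) \<omega>) \<le> return_time (queue []) [] \<omega>" .
    qed
    finally show ?thesis unfolding C using C(1) by simp
  qed
  then have "summable (\<lambda>n. \<kappa>' / real (Suc n))"
    using \<kappa>' by (intro summableI_nonneg_bounded[of _ C]) auto
  then have "summable (\<lambda>n. inverse \<kappa>' * (\<kappa>' / real (Suc n)))"
    by (rule summable_mult)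
  then have "summable (\<lambda>n. inverse (real (Suc n)))"
    using \<kappa>' by (simp add: field_simps)
  then show False
    using summable_Suc_iff[of "\<lambda>n. inverse (real n)"] not_summable_harmonic[where 'a = real] by simp
qed

text \<open>The mean is at most the sum over \<open>n\<close> of the probabilities of no return by
  time \<open>n\<close>. Summing first over \<open>n\<close> and then over the number
  \<open>m\<close> of letters leaves the discrete probabilities with coefficients bounded uniformly
  in \<open>m\<close> (\<open>suminf_poisson_le\<close>), in essence the expected time spent with
  exactly \<open>m\<close> arrivals.\<close>

lemma stable_imp_finite_return_time:
  assumes stable
  shows "(\<integral>\<^sup>+\<omega>. return_time (queue x) x \<omega> \<partial>M) < \<infinity>"
proof -
  let ?L = "sum rate UNIV"
  let ?a = "no_return_prob (queue_step E) (letter_pmf rate) x"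
  \<comment> \<open>Any customer arrival changes every state, so it serves as the letter that leaves
    \<open>x\<close>.\<close>
  fix c0 :: 'c
  have "0 < pmf (letter_pmf rate) (Inl c0)"
    using sum_rate_pos rate_pos by (simp add: pmf_letter_rate)
  then obtain S where S: "\<And>N. (\<Sum>m<N. ?a m) \<le> S"
    using sum_no_return_prob_bounded[OF equilibrium_invariant[OF assms] pmf_equilibrium_pos[OF assms],
      where k = "Inl c0"] by auto
  have "AE \<omega> in M. \<forall>n. 0 < n \<longrightarrow> (\<exists>m. resolved (\<lambda>k. A k \<omega>) 0 (real n) m)"
    using AE_resolved by (auto simp: AE_all_countable)
  then have "AE \<omega> in M. return_time (queue x) x \<omega> \<le> (\<Sum>n. indicator (no_return_event x n) \<omega>)"
    using AE_space
  proof eventually_elim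
    case (elim \<omega>)
    show ?case
    proof (cases "\<forall>n. \<omega> \<in> no_return_event x n")
      case True
      have le: "of_nat N \<le> (\<Sum>n. indicator (no_return_event x n) \<omega> :: ennreal)" for N
      proof -
        have "of_nat N = (\<Sum>n<N. indicator (no_return_event x n) \<omega> :: ennreal)"
          using True by (simp add: indicator_def)
        also have "\<dots> \<le> (\<Sum>n. indicator (no_return_event x n) \<omega>)"
          by (intro sum_le_suminf) auto
        finally show ?thesis .
      qed
      have "(\<Sum>n. indicator (no_return_event x n) \<omega> :: ennreal) = top"
      proof (rule ccontr)
        assume "(\<Sum>n. indicator (no_return_event x n) \<omega> :: ennreal) \<noteq> top"
        then obtain c where c: "(\<Sum>n. indicator (no_return_event x n) \<omega> :: ennreal) = ennreal c" "0 \<le> c"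
          by (cases "\<Sum>n. indicator (no_return_event x n) \<omega> :: ennreal") auto
        obtain N where "c < real N" using reals_Archimedean2 by blast
        moreover have "ennreal (real N) \<le> ennreal c"
          using le[of N] c by (simp add: ennreal_of_nat_eq_real_of_nat)
        ultimately show False using c by simp
      qed
      then show ?thesis by simp
    next
      case False
      define N where "N = (LEAST n. \<omega> \<notin> no_return_event x n)"
      obtain n where "\<omega> \<notin> no_return_event x n" using False by blast
      then have N: "\<omega> \<notin> no_return_event x N" unfolding N_def by (rule LeastI)
      have less: "\<omega> \<in> no_return_event x n" if "n < N" for n
        using not_less_Least[of n "\<lambda>n. \<omega> \<notin> no_return_event x n"] that unfolding N_def by blast
      have "N \<noteq> 0" using N elim by (intro notI) simp
      then obtain m where "resolved (\<lambda>k. A k \<omega>) 0 (real N) m" using elim by blast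
      then have "return_time (queue x) x \<omega> \<le> of_nat N"
        using N elim by (intro return_time_le) auto
      also have "\<dots> = (\<Sum>n<N. indicator (no_return_event x n) \<omega>)"
        using less by (simp add: indicator_def)
      also have "\<dots> \<le> (\<Sum>n. indicator (no_return_event x n) \<omega>)"
        by (intro sum_le_suminf) auto
      finally show ?thesis .
    qed
  qed
  then have "(\<integral>\<^sup>+\<omega>. return_time (queue x) x \<omega> \<partial>M) \<le>
      (\<integral>\<^sup>+\<omega>. (\<Sum>n. indicator (no_return_event x n) \<omega>) \<partial>M)"
    by (rule nn_integral_mono_AE)
  also have "\<dots> = (\<Sum>n. emeasure M (no_return_event x n))"
    using sets_no_return_event by (subst nn_integral_suminf) auto
  \<comment> \<open>The term at time 0 is split off, since the Poisson mixture describes positive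
    times only.\<close>
  also have "\<dots> = emeasure M (no_return_event x 0) + (\<Sum>n. emeasure M (no_return_event x (Suc n)))"
    using suminf_offset[of "\<lambda>n. emeasure M (no_return_event x n)" 1] by (simp add: add.commute)
  also have "(\<Sum>n. emeasure M (no_return_event x (Suc n))) =
      (\<Sum>n. \<integral>\<^sup>+m. ennreal (pmf (poisson_pmf (?L * real (Suc n))) m) * ennreal (?a m) \<partial>count_space UNIV)"
    by (simp only: emeasure_no_return_event[OF zero_less_Suc] nn_integral_measure_pmf)
  also have "\<dots> =
      (\<integral>\<^sup>+m. (\<Sum>n. ennreal (pmf (poisson_pmf (?L * real (Suc n))) m) * ennreal (?a m)) \<partial>count_space UNIV)"
    by (subst nn_integral_suminf) auto
  also have "\<dots> \<le> (\<integral>\<^sup>+m. ennreal (exp ?L / ?L) * ennreal (?a m) \<partial>count_space UNIV)"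
    using suminf_poisson_le[OF sum_rate_pos]
    by (intro nn_integral_mono) (simp only: ennreal_suminf_multc mult_right_mono zero_le)
  also have "\<dots> = ennreal (exp ?L / ?L) * (\<Sum>m. ennreal (?a m))"
    by (subst nn_integral_cmult) (auto simp: nn_integral_count_space_nat)
  also have "\<dots> \<le> ennreal (exp ?L / ?L) * ennreal S"
  proof (intro mult_left_mono suminf_le_const)
    show "(\<Sum>m<N. ennreal (?a m)) \<le> ennreal S" for N
      using S[of N] by (subst sum_ennreal) (auto intro: ennreal_leI)
  qed auto
  finally have "(\<integral>\<^sup>+\<omega>. return_time (queue x) x \<omega> \<partial>M) \<le>
      emeasure M (no_return_event x 0) + ennreal (exp ?L / ?L) * ennreal S"
    by (simp add: add_left_mono)
  also have "\<dots> < \<infinity>" by (simp add: emeasure_eq_measure ennreal_mult_less_top)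
  finally show ?thesis .
qed

lemma ergodic_iff_stable: "ergodic M queue \<longleftrightarrow> stable"
proof
  assume "ergodic M queue"
  then have "(\<integral>\<^sup>+\<omega>. return_time (queue []) [] \<omega> \<partial>M) < \<infinity>"
    unfolding ergodic_def positive_recurrent_def by blast
  then show stable using not_stable_imp_infinite_return_time by (cases stable) auto
next
  assume stable
  then show "ergodic M queue"
    unfolding ergodic_def positive_recurrent_def
    using stable_imp_finite_return_time irreducible_queue by blast
qed

end

theorem theorem2p5:
  fixes M :: "'w measure"
    and E :: "('s::finite \<times> 'c::finite) set"
    and lam :: "'c \<Rightarrow> real" and mu :: "'s \<Rightarrow> real"
    and A :: "'c + 's \<Rightarrow> 'w \<Rightarrow> real set"
  assumes "prob_space M"
    and "\<And>c. lam c > 0" and "\<And>s. mu s > 0"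
    and "\<And>c. poisson_stream M (lam c) (A (Inl c))"
    and "\<And>s. poisson_stream M (mu s) (A (Inr s))"
    and "independent_streams M A"
  shows "(\<forall>X0. independent_initial_state M A X0 \<longrightarrow>
            markov_chain M (transition_prob M (matching_queue E A))
              (\<lambda>t \<omega>. matching_queue E A (X0 \<omega>) t \<omega>)) \<and>
         (ergodic M (matching_queue E A) \<longleftrightarrow>
            (\<forall>C. C \<noteq> {} \<longrightarrow> sum lam C < sum mu (compatible_servers E C))) \<and>
         (ergodic M (matching_queue E A) \<longrightarrow>
            (\<exists>B>0. \<forall>p. stationary_distribution (transition_prob M (matching_queue E A)) p \<longleftrightarrow>
               p = (\<lambda>q. B * (\<Prod>l<length q. lam (q ! l) /
                      sum mu (compatible_servers E (set (take (Suc l) q)))))))"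
proof -
  interpret matching_rates E lam mu by unfold_locales (rule assms)+
  interpret prob_space M by (rule assms)
  interpret fcfs_queue M E lam mu A
  proof unfold_locales
    show "0 < rate k" for k by (rule rate_pos)
    show "poisson_stream M (rate k) (A k)" for k
      using assms by (cases k) (auto simp: rate_def)
  qed (rule assms)
  have markov: "markov_chain M (transition_prob M queue) (\<lambda>t \<omega>. queue (X0 \<omega>) t \<omega>)"
    if "independent_initial_state M A X0" for X0
    using past_initial_state[OF that] by (rule markov_chain_queue)
  have erg: "ergodic M queue \<longleftrightarrow> (\<forall>C. C \<noteq> {} \<longrightarrow> sum lam C < sum mu (compatible_servers E C))"
    unfolding ergodic_iff_stable stable_def srv_def ..
  have weight: "(\<lambda>q. B * (\<Prod>l<length q. lam (q ! l) / sum mu (compatible_servers E (set (take (Suc l) q))))) =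
      (\<lambda>q. B * weight {} q)" for B
    using prod_eq_weight[of _ "{}"] by (simp add: srv_def)
  have stat: "\<exists>B>0. \<forall>p. stationary_distribution (transition_prob M queue) p \<longleftrightarrow>
      p = (\<lambda>q. B * weight {} q)" if "ergodic M queue"
  proof -
    have st: stable using that ergodic_iff_stable by simp
    have "pmf equilibrium = (\<lambda>q. inverse (infsum (weight {}) UNIV) * weight {} q)"
      using pmf_equilibrium[OF st] by auto
    then show ?thesis
      using stationary_distribution_iff[OF st] infsum_weight_pos[OF st]
      by (intro exI[of _ "inverse (infsum (weight {}) UNIV)"]) simp
  qed
  show ?thesis
    unfolding weight using markov erg stat by blast
qed

end
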